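(* Let $R$ be a commutative ring, $N=\mathrm{N}_3(R)$ and $M=\mathrm{M}_3(R)$. Then $H^n(N,M/N)$ is a free $R$-module for all $n\ge0$, with $\mathrm{rank}_R H^0(N,M/N)=2$ and $\mathrm{rank}_RH^n(N,M/N)=n+1$ for $n\ge1$.
   Context: $\mathrm{N}_3(R)=\left\{\begin{pmatrix}a&b&c\\0&a&d\\0&0&a\end{pmatrix}\mid a,b,c,d\in R\right\}\subseteq\mathrm{M}_3(R)$. $H^n$ is Hochschild cohomology, with $M/N$ an $N$-bimodule via matrix multiplication. *)

theory Defs
  imports "HOL-Analysis.Analysis"
begin

type_synonym 'r mat3 = "('r^3)^3"

definition N3 :: "('r::comm_ring_1) mat3 set" where
  "N3 = {A. A$(1::3)$(1::3) = A$2$2 \<and> A$(2::3)$(2::3) = A$3$3 \<and> A$(2::3)$(1::3) = 0 \<and> A$(3::3)$(1::3) = 0 \<and> A$(3::3)$(2::3) = 0}"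

definition smat :: "'r::comm_ring_1 \<Rightarrow> 'r mat3 \<Rightarrow> 'r mat3" where
  "smat c A = (\<chi> i j. c * A$i$j)"

lemma N3_zero: "0 \<in> N3"
  by (simp add: N3_def)

lemma N3_diff: "A \<in> N3 \<Longrightarrow> B \<in> N3 \<Longrightarrow> A - B \<in> N3"
  by (simp add: N3_def)

lemma N3_add: "A \<in> N3 \<Longrightarrow> B \<in> N3 \<Longrightarrow> A + B \<in> N3"
  by (simp add: N3_def)

lemma N3_uminus: "A \<in> N3 \<Longrightarrow> - A \<in> N3"
  by (simp add: N3_def)

lemma N3_eq: "X = Y \<Longrightarrow> X \<in> N3 \<Longrightarrow> Y \<in> N3"
  by simp

lemma N3_mult: "A \<in> N3 \<Longrightarrow> B \<in> N3 \<Longrightarrow> (A ** B) \<in> (N3 :: ('r::comm_ring_1) mat3 set)"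
  by (simp add: N3_def matrix_matrix_mult_def sum_3)

lemma mat_mult_diff_left: "(a::('r::comm_ring_1) mat3) ** (A - B) = a ** A - a ** B"
  by (simp add: vec_eq_iff matrix_matrix_mult_def sum_subtractf[symmetric] algebra_simps)

lemma mat_mult_diff_right: "((A::('r::comm_ring_1) mat3) - B) ** a = A ** a - B ** a"
  by (simp add: vec_eq_iff matrix_matrix_mult_def sum_subtractf[symmetric] algebra_simps)

lemma smat_diff: "smat c A - smat c B \<in> N3" if "A - B \<in> N3"
proof -
  have "smat c A - smat c B = smat c (A - B)" by (simp add: smat_def vec_eq_iff algebra_simps)
  with that show ?thesis by (simp add: N3_def smat_def)
qed

definition mrel :: "('r::comm_ring_1) mat3 \<Rightarrow> 'r mat3 \<Rightarrow> bool" where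
  "mrel A B \<longleftrightarrow> A - B \<in> N3"

lemma N3_sym: "A - B \<in> N3 \<Longrightarrow> B - A \<in> (N3 :: ('r::comm_ring_1) mat3 set)"
proof -
  assume "A - B \<in> N3"
  then have "- (A - B) \<in> N3" by (rule N3_uminus)
  then show ?thesis by simp
qed

lemma N3_trans: "A - B \<in> N3 \<Longrightarrow> B - C \<in> N3 \<Longrightarrow> A - C \<in> (N3 :: ('r::comm_ring_1) mat3 set)"
proof -
  assume "A - B \<in> N3" "B - C \<in> N3"
  then have "(A - B) + (B - C) \<in> N3" by (rule N3_add)
  then show ?thesis by simp
qed

lemma N3_plus2: "A - B \<in> N3 \<Longrightarrow> C - D \<in> N3 \<Longrightarrow> (A + C) - (B + D) \<in> (N3 :: ('r::comm_ring_1) mat3 set)"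
proof -
  assume "A - B \<in> N3" "C - D \<in> N3"
  then have "(A - B) + (C - D) \<in> N3" by (rule N3_add)
  moreover have eq: "(A + C) - (B + D) = (A - B) + (C - D)" by (simp add: algebra_simps)
  ultimately show ?thesis by (simp only: eq)
qed

lemma N3_minus2: "A - B \<in> N3 \<Longrightarrow> C - D \<in> N3 \<Longrightarrow> (A - C) - (B - D) \<in> (N3 :: ('r::comm_ring_1) mat3 set)"
proof -
  assume "A - B \<in> N3" "C - D \<in> N3"
  then have "(A - B) - (C - D) \<in> N3" by (rule N3_diff)
  moreover have eq: "(A - C) - (B - D) = (A - B) - (C - D)" by (simp add: algebra_simps)
  ultimately show ?thesis by (simp only: eq)
qed

lemma N3_uminus2: "A - B \<in> N3 \<Longrightarrow> (- A) - (- B) \<in> (N3 :: ('r::comm_ring_1) mat3 set)"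
proof -
  assume "A - B \<in> N3"
  then have "- (A - B) \<in> N3" by (rule N3_uminus)
  then show ?thesis by simp
qed

lemma equivp_mrel: "equivp mrel"
proof (rule equivpI)
  show "reflp mrel" by (simp add: reflp_def mrel_def N3_zero)
  show "symp mrel" unfolding mrel_def by (rule sympI) (rule N3_sym)
  show "transp mrel" unfolding mrel_def by (rule transpI) (rule N3_trans)
qed

quotient_type (overloaded) 'r MmodN = "('r::comm_ring_1) mat3" / mrel
  by (rule equivp_mrel)

instantiation MmodN :: (comm_ring_1) ab_group_add
begin
lift_definition zero_MmodN :: "'a MmodN" is 0 .
lift_definition plus_MmodN :: "'a MmodN \<Rightarrow> 'a MmodN \<Rightarrow> 'a MmodN" is "(+)"
  unfolding mrel_def by (rule N3_plus2)
lift_definition uminus_MmodN :: "'a MmodN \<Rightarrow> 'a MmodN" is uminus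
  unfolding mrel_def by (rule N3_uminus2)
lift_definition minus_MmodN :: "'a MmodN \<Rightarrow> 'a MmodN \<Rightarrow> 'a MmodN" is "(-)"
  unfolding mrel_def by (rule N3_minus2)
instance
  by standard (transfer; simp add: mrel_def N3_zero algebra_simps)+
end

lift_definition qscale :: "'r::comm_ring_1 \<Rightarrow> 'r MmodN \<Rightarrow> 'r MmodN" is smat
  by (simp add: mrel_def smat_diff)

text \<open>N-bimodule structure on M/N by matrix multiplication (only used for a in N;
  the value for a outside N is irrelevant and fixed to 0).\<close>
lift_definition lact :: "('r::comm_ring_1) mat3 \<Rightarrow> 'r MmodN \<Rightarrow> 'r MmodN"
  is "\<lambda>a A. if a \<in> N3 then a ** A else 0"
  by (auto simp: mrel_def mat_mult_diff_left[symmetric] N3_mult) (simp add: N3_def)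

lift_definition ract :: "'r MmodN \<Rightarrow> ('r::comm_ring_1) mat3 \<Rightarrow> 'r MmodN"
  is "\<lambda>A a. if a \<in> N3 then A ** a else 0"
  by (auto simp: mrel_def mat_mult_diff_right[symmetric] N3_mult) (simp add: N3_def)

text \<open>An n-cochain is an R-multilinear map N^n \<rightarrow> M/N (equivalently an R-linear map
  N^{\<otimes>n} \<rightarrow> M/N). It is represented as a function on lists, normalised to 0 on lists
  that are not of length n with entries in N.\<close>

definition valid_args :: "nat \<Rightarrow> ('r::comm_ring_1) mat3 list \<Rightarrow> bool" where
  "valid_args n xs \<longleftrightarrow> length xs = n \<and> set xs \<subseteq> N3"

definition hoch_cochains :: "nat \<Rightarrow> (('r::comm_ring_1) mat3 list \<Rightarrow> 'r MmodN) set" where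
  "hoch_cochains n = {f.
     (\<forall>xs. \<not> valid_args n xs \<longrightarrow> f xs = 0) \<and>
     (\<forall>xs ys x y c. length xs + length ys + 1 = n \<and> set xs \<subseteq> N3 \<and> set ys \<subseteq> N3
        \<and> x \<in> N3 \<and> y \<in> N3 \<longrightarrow>
          f (xs @ (x + y) # ys) = f (xs @ x # ys) + f (xs @ y # ys) \<and>
          f (xs @ smat c x # ys) = qscale c (f (xs @ x # ys)))}"

definition hoch_d :: "nat \<Rightarrow> (('r::comm_ring_1) mat3 list \<Rightarrow> 'r MmodN)
                          \<Rightarrow> ('r mat3 list \<Rightarrow> 'r MmodN)" where
  "hoch_d n f xs = (if valid_args (Suc n) xs then
       lact (xs ! 0) (f (tl xs))
     + (\<Sum>i<n. qscale ((-1) ^ (i + 1)) (f (take i xs @ (xs ! i ** xs ! (i + 1)) # drop (i + 2) xs)))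
     + qscale ((-1) ^ (n + 1)) (ract (f (take n xs)) (xs ! n))
     else 0)"

definition hoch_cocycles :: "nat \<Rightarrow> (('r::comm_ring_1) mat3 list \<Rightarrow> 'r MmodN) set" where
  "hoch_cocycles n = {f \<in> hoch_cochains n. hoch_d n f = (\<lambda>_. 0)}"

definition hoch_coboundaries :: "nat \<Rightarrow> (('r::comm_ring_1) mat3 list \<Rightarrow> 'r MmodN) set" where
  "hoch_coboundaries n = (if n = 0 then {\<lambda>_. 0} else hoch_d (n - 1) ` hoch_cochains (n - 1))"

definition hoch_lincomb :: "nat \<Rightarrow> (nat \<Rightarrow> 'r::comm_ring_1) \<Rightarrow> (nat \<Rightarrow> ('r mat3 list \<Rightarrow> 'r MmodN))
                             \<Rightarrow> ('r mat3 list \<Rightarrow> 'r MmodN)" where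
  "hoch_lincomb k r z = (\<lambda>xs. \<Sum>i<k. qscale (r i) (z i xs))"

definition hoch_free_of_rank :: "('r::comm_ring_1) itself \<Rightarrow> nat \<Rightarrow> nat \<Rightarrow> bool" where
  "hoch_free_of_rank TYPE('r) n k \<longleftrightarrow>
     (\<exists>z :: nat \<Rightarrow> ('r mat3 list \<Rightarrow> 'r MmodN).
        (\<forall>i<k. z i \<in> hoch_cocycles n) \<and>
        (\<forall>f \<in> hoch_cocycles n. \<exists>r. (\<lambda>xs. f xs - hoch_lincomb k r z xs) \<in> hoch_coboundaries n) \<and>
        (\<forall>r. hoch_lincomb k r z \<in> hoch_coboundaries n \<longrightarrow> (\<forall>i<k. r i = 0)))"

end

theory Submission
  imports Defs
begin

text \<open>The algebra N is \<open>R\<langle>x, y\<rangle>/(x\<^sup>2, y\<^sup>2, yx)\<close> with \<open>x = E12\<close>, \<open>y = E23\<close>, hence Koszul, and its Koszul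
  bimodule resolution has generators \<open>y\<^sup>i x\<^sup>j\<close> with \<open>i + j = n\<close> in degree \<open>n\<close>. An algebraic
  Morse matching on words in the basis \<open>1, x, y, z = xy\<close> shows that a Hochschild cocycle that vanishes
  on these words is a coboundary. The rest is linear algebra in the five coordinates of M/N: for \<open>n \<ge> 1\<close>,
  modulo coboundaries, a cocycle is determined by one diagonal coordinate at each of the \<open>n + 1\<close>
  words, and the cochains supported at a single such word with diagonal value are cocycles.\<close>

section \<open>The bimodule M/N\<close>

text \<open>Cochains are not normalised: they may be nonzero on lists containing the identity
  matrix, so the matching must also cancel runs of the letter \<open>One\<close>. No resolution and
  no comparison map is built; the Koszul complex only appears as the bar differential evaluated on
  critical words. The ranks come from a count. M/N has rank 5 and there are n+1 critical words in
  degree n. Being a cocycle there imposes 2n+3 independent conditions: \<open>entry31\<close>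
  vanishes at every word, one further entry vanishes at each of the two end words, and n equations
  link neighbouring words. For n >= 1 this leaves 5(n+1) - (2n+3) - (2n+1) = n+1. In degree 0
  nothing is divided out, and 5 - 3 = 2 remains. Since 2 need not be invertible in R, the diagonal
  class used as a generator has to be chosen with care at the two end words.\<close>

lemma mrel_eqI: "A = B \<Longrightarrow> mrel A B"
  by (simp add: mrel_def N3_zero)

lemma smat_in_N3: "x \<in> N3 \<Longrightarrow> smat c x \<in> N3"
  by (simp add: N3_def smat_def)

lemma qscale_add_right: "qscale c (m + m') = qscale c m + qscale c m'"
  by transfer (rule mrel_eqI, simp add: smat_def vec_eq_iff algebra_simps)

lemma qscale_add_left: "qscale (c + d) m = qscale c m + qscale d m"
  by transfer (rule mrel_eqI, simp add: smat_def vec_eq_iff algebra_simps)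

lemma qscale_mult: "qscale (c * d) m = qscale c (qscale d m)"
  by transfer (rule mrel_eqI, simp add: smat_def vec_eq_iff algebra_simps)

lemma qscale_one [simp]: "qscale 1 m = m"
  by transfer (rule mrel_eqI, simp add: smat_def vec_eq_iff)

lemma qscale_zero [simp]: "qscale 0 m = 0"
  by transfer (rule mrel_eqI, simp add: smat_def vec_eq_iff)

lemma qscale_zero_right [simp]: "qscale c 0 = 0"
  by transfer (rule mrel_eqI, simp add: smat_def vec_eq_iff)

lemma qscale_minus_left [simp]: "qscale (- c) m = - qscale c m"
  by transfer (rule mrel_eqI, simp add: smat_def vec_eq_iff)

lemma qscale_minus_right [simp]: "qscale c (- m) = - qscale c m"
  by transfer (rule mrel_eqI, simp add: smat_def vec_eq_iff)

lemma qscale_diff_right: "qscale c (m - m') = qscale c m - qscale c m'"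
  by transfer (rule mrel_eqI, simp add: smat_def vec_eq_iff algebra_simps)

lemma lact_add: "lact a (m + m') = lact a m + lact a m'"
  by transfer (rule mrel_eqI, simp add: vec_eq_iff matrix_matrix_mult_def sum_3 algebra_simps)

lemma lact_zero [simp]: "lact a 0 = 0"
  using lact_add[of a 0 0] by simp

lemma lact_minus [simp]: "lact a (- m) = - lact a m"
  using lact_add[of a m "- m"] by (simp add: eq_neg_iff_add_eq_0 add.commute)

lemma lact_diff: "lact a (m - m') = lact a m - lact a m'"
  using lact_add[of a m "- m'"] by simp

lemma lact_qscale: "lact a (qscale c m) = qscale c (lact a m)"
  by transfer (rule mrel_eqI, simp add: smat_def vec_eq_iff matrix_matrix_mult_def sum_3 algebra_simps)

lemma lact_add_left: "a \<in> N3 \<Longrightarrow> b \<in> N3 \<Longrightarrow> lact (a + b) m = lact a m + lact b m"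
  by transfer (rule mrel_eqI, simp add: N3_add vec_eq_iff matrix_matrix_mult_def sum_3 algebra_simps)

lemma lact_smat: "a \<in> N3 \<Longrightarrow> lact (smat c a) m = qscale c (lact a m)"
  by transfer (rule mrel_eqI, simp add: smat_in_N3,
      simp add: smat_def vec_eq_iff matrix_matrix_mult_def sum_3 algebra_simps)

lemma lact_mult: "a \<in> N3 \<Longrightarrow> b \<in> N3 \<Longrightarrow> lact (a ** b) m = lact a (lact b m)"
  by transfer (rule mrel_eqI, simp add: N3_mult matrix_mul_assoc)

lemma ract_add: "ract (m + m') a = ract m a + ract m' a"
  by transfer (rule mrel_eqI, simp add: vec_eq_iff matrix_matrix_mult_def sum_3 algebra_simps)

lemma ract_zero [simp]: "ract 0 a = 0"
  using ract_add[of 0 0 a] by simp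

lemma ract_minus [simp]: "ract (- m) a = - ract m a"
  using ract_add[of m "- m" a] by (simp add: eq_neg_iff_add_eq_0 add.commute)

lemma ract_qscale: "ract (qscale c m) a = qscale c (ract m a)"
  by transfer (rule mrel_eqI, simp add: smat_def vec_eq_iff matrix_matrix_mult_def sum_3 algebra_simps)

lemma ract_add_right: "a \<in> N3 \<Longrightarrow> b \<in> N3 \<Longrightarrow> ract m (a + b) = ract m a + ract m b"
  by transfer (rule mrel_eqI, simp add: N3_add vec_eq_iff matrix_matrix_mult_def sum_3 algebra_simps)

lemma ract_smat: "a \<in> N3 \<Longrightarrow> ract m (smat c a) = qscale c (ract m a)"
  by transfer (rule mrel_eqI, simp add: smat_in_N3,
      simp add: smat_def vec_eq_iff matrix_matrix_mult_def sum_3 algebra_simps)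

lemma ract_mult: "a \<in> N3 \<Longrightarrow> b \<in> N3 \<Longrightarrow> ract m (a ** b) = ract (ract m a) b"
  by transfer (rule mrel_eqI, simp add: N3_mult matrix_mul_assoc)

lemma lact_ract: "a \<in> N3 \<Longrightarrow> b \<in> N3 \<Longrightarrow> lact a (ract m b) = ract (lact a m) b"
  by transfer (rule mrel_eqI, simp add: matrix_mul_assoc)

section \<open>Coordinates on the quotient M/N\<close>

definition unit_mat :: "3 \<Rightarrow> 3 \<Rightarrow> ('r::comm_ring_1) mat3" where
  "unit_mat i j = (\<chi> k l. if k = i \<and> l = j then 1 else 0)"

lift_definition unit_class :: "3 \<Rightarrow> 3 \<Rightarrow> ('r::comm_ring_1) MmodN" is unit_mat .

lift_definition entry31 :: "('r::comm_ring_1) MmodN \<Rightarrow> 'r" is "\<lambda>A. A$3$1"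
  by (simp add: mrel_def N3_def)
lift_definition entry21 :: "('r::comm_ring_1) MmodN \<Rightarrow> 'r" is "\<lambda>A. A$2$1"
  by (simp add: mrel_def N3_def)
lift_definition entry32 :: "('r::comm_ring_1) MmodN \<Rightarrow> 'r" is "\<lambda>A. A$3$2"
  by (simp add: mrel_def N3_def)
text \<open>Modulo scalar matrices, diag(a,b,c) is (a-b) E11 + (c-b) E33.\<close>
lift_definition diag1 :: "('r::comm_ring_1) MmodN \<Rightarrow> 'r" is "\<lambda>A. A$1$1 - A$2$2"
  by (simp add: mrel_def N3_def algebra_simps)
lift_definition diag3 :: "('r::comm_ring_1) MmodN \<Rightarrow> 'r" is "\<lambda>A. A$3$3 - A$2$2"
  by (simp add: mrel_def N3_def algebra_simps)

text \<open>N contains the strict upper triangle and the scalar matrices, so a class retains the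
  strict lower triangle and the differences of diagonal entries: M/N is free of rank 5.\<close>

lemma MmodN_eqI:
  assumes "entry31 m = entry31 m'" "entry21 m = entry21 m'" "entry32 m = entry32 m'"
    "diag1 m = diag1 m'" "diag3 m = diag3 m'"
  shows "m = m'"
  using assms by transfer (auto simp: mrel_def N3_def algebra_simps)

lemma coords_zero [simp]:
  "entry31 0 = 0" "entry21 0 = 0" "entry32 0 = 0" "diag1 0 = 0" "diag3 0 = 0"
  by (transfer; simp)+

lemma coords_add [simp]:
  "entry31 (m + m') = entry31 m + entry31 m'" "entry21 (m + m') = entry21 m + entry21 m'"
  "entry32 (m + m') = entry32 m + entry32 m'" "diag1 (m + m') = diag1 m + diag1 m'"
  "diag3 (m + m') = diag3 m + diag3 m'"
  by (transfer; simp)+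

lemma coords_diff [simp]:
  "entry31 (m - m') = entry31 m - entry31 m'" "entry21 (m - m') = entry21 m - entry21 m'"
  "entry32 (m - m') = entry32 m - entry32 m'" "diag1 (m - m') = diag1 m - diag1 m'"
  "diag3 (m - m') = diag3 m - diag3 m'"
  by (transfer; simp)+

lemma coords_qscale [simp]:
  "entry31 (qscale c m) = c * entry31 m" "entry21 (qscale c m) = c * entry21 m"
  "entry32 (qscale c m) = c * entry32 m" "diag1 (qscale c m) = c * diag1 m"
  "diag3 (qscale c m) = c * diag3 m"
  by (transfer; simp add: smat_def algebra_simps)+

lemma coords_unit_class [simp]:
  "entry31 (unit_class 3 1) = 1" "entry21 (unit_class 3 1) = 0" "entry32 (unit_class 3 1) = 0"
  "diag1 (unit_class 3 1) = 0" "diag3 (unit_class 3 1) = 0"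
  "entry31 (unit_class 2 1) = 0" "entry21 (unit_class 2 1) = 1" "entry32 (unit_class 2 1) = 0"
  "diag1 (unit_class 2 1) = 0" "diag3 (unit_class 2 1) = 0"
  "entry31 (unit_class 3 2) = 0" "entry21 (unit_class 3 2) = 0" "entry32 (unit_class 3 2) = 1"
  "diag1 (unit_class 3 2) = 0" "diag3 (unit_class 3 2) = 0"
  "entry31 (unit_class 1 1) = 0" "entry21 (unit_class 1 1) = 0" "entry32 (unit_class 1 1) = 0"
  "diag1 (unit_class 1 1) = 1" "diag3 (unit_class 1 1) = 0"
  "entry31 (unit_class 3 3) = 0" "entry21 (unit_class 3 3) = 0" "entry32 (unit_class 3 3) = 0"
  "diag1 (unit_class 3 3) = 0" "diag3 (unit_class 3 3) = 1"
  by (transfer; simp add: unit_mat_def)+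

section \<open>Words in the basis of N\<close>

datatype letter = One | X | Y | Z

fun mat_of :: "letter \<Rightarrow> ('r::comm_ring_1) mat3" where
  "mat_of One = mat 1"
| "mat_of X = unit_mat 1 2"
| "mat_of Y = unit_mat 2 3"
| "mat_of Z = unit_mat 1 3"

fun coord :: "letter \<Rightarrow> ('r::comm_ring_1) mat3 \<Rightarrow> 'r" where
  "coord One x = x$1$1"
| "coord X x = x$1$2"
| "coord Y x = x$2$3"
| "coord Z x = x$1$3"

text \<open>The value None stands for the product 0.\<close>
fun mul :: "letter \<Rightarrow> letter \<Rightarrow> letter option" where
  "mul One b = Some b"
| "mul a One = Some a"
| "mul X Y = Some Z"
| "mul _ _ = None"

lemma mat_of_in_N3 [simp]: "mat_of a \<in> N3"
  by (cases a) (simp_all add: N3_def mat_def unit_mat_def)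

lemma map_mat_of_in_N3 [simp]: "set (map mat_of ws) \<subseteq> N3"
  by auto

lemma mat_of_mult:
  "mat_of a ** mat_of b = (case mul a b of None \<Rightarrow> 0 | Some p \<Rightarrow> mat_of p)"
  by (cases a; cases b)
    (simp_all add: vec_eq_iff matrix_matrix_mult_def sum_3 forall_3 unit_mat_def mat_def)

lemma coord_mat_of [simp]: "coord a (mat_of b) = (if a = b then 1 else 0)"
  by (cases a; cases b) (simp_all add: unit_mat_def mat_def)

lemma coord_add [simp]: "coord a (x + y) = coord a x + coord a y"
  by (cases a) simp_all

lemma coord_smat [simp]: "coord a (smat c x) = c * coord a x"
  by (cases a) (simp_all add: smat_def)

lemma N3_expand:
  assumes "x \<in> N3"
  shows "x = smat (coord One x) (mat_of One) + smat (coord X x) (mat_of X)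
    + smat (coord Y x) (mat_of Y) + smat (coord Z x) (mat_of Z)"
  using assms by (simp add: N3_def vec_eq_iff forall_3 smat_def mat_def unit_mat_def)

lemma lact_One [simp]: "lact (mat 1) m = m"
  by transfer (rule mrel_eqI, simp add: N3_def mat_def[of 1],
      simp add: vec_eq_iff matrix_matrix_mult_def sum_3 forall_3 mat_def)

lemma ract_One [simp]: "ract m (mat 1) = m"
  by transfer (rule mrel_eqI, simp add: N3_def mat_def[of 1],
      simp add: vec_eq_iff matrix_matrix_mult_def sum_3 forall_3 mat_def)

lemma unit_mat_in_N3:
  "unit_mat 1 2 \<in> N3" "unit_mat 2 3 \<in> N3" "unit_mat 1 3 \<in> N3"
  by (simp_all add: N3_def unit_mat_def)

lemma coords_lact_X [simp]:
  "entry31 (lact (unit_mat 1 2) m) = 0" "entry21 (lact (unit_mat 1 2) m) = 0"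
  "entry32 (lact (unit_mat 1 2) m) = 0" "diag1 (lact (unit_mat 1 2) m) = entry21 m"
  "diag3 (lact (unit_mat 1 2) m) = 0"
  by (transfer; simp add: unit_mat_in_N3; simp add: unit_mat_def matrix_matrix_mult_def sum_3)+

text \<open>Row 3 moves to row 2. A value landing in place (2,2) is subtracted in both
  \<open>diag1\<close> and \<open>diag3\<close>, hence the two minus signs; the same happens for
  \<open>X\<close> acting on the right.\<close>

lemma coords_lact_Y [simp]:
  "entry31 (lact (unit_mat 2 3) m) = 0" "entry21 (lact (unit_mat 2 3) m) = entry31 m"
  "entry32 (lact (unit_mat 2 3) m) = 0" "diag1 (lact (unit_mat 2 3) m) = - entry32 m"
  "diag3 (lact (unit_mat 2 3) m) = - entry32 m"
  by (transfer; simp add: unit_mat_in_N3; simp add: unit_mat_def matrix_matrix_mult_def sum_3)+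

lemma coords_ract_X [simp]:
  "entry31 (ract m (unit_mat 1 2)) = 0" "entry21 (ract m (unit_mat 1 2)) = 0"
  "entry32 (ract m (unit_mat 1 2)) = entry31 m" "diag1 (ract m (unit_mat 1 2)) = - entry21 m"
  "diag3 (ract m (unit_mat 1 2)) = - entry21 m"
  by (transfer; simp add: unit_mat_in_N3; simp add: unit_mat_def matrix_matrix_mult_def sum_3)+

lemma coords_ract_Y [simp]:
  "entry31 (ract m (unit_mat 2 3)) = 0" "entry21 (ract m (unit_mat 2 3)) = 0"
  "entry32 (ract m (unit_mat 2 3)) = 0" "diag1 (ract m (unit_mat 2 3)) = 0"
  "diag3 (ract m (unit_mat 2 3)) = entry32 m"
  by (transfer; simp add: unit_mat_in_N3; simp add: unit_mat_def matrix_matrix_mult_def sum_3)+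

lemma unit_mat_13: "unit_mat 1 3 = unit_mat 1 2 ** (unit_mat 2 3 :: ('r::comm_ring_1) mat3)"
  by (rule mat_of_mult[of X Y, simplified, symmetric])

text \<open>\<open>E11\<close> and \<open>E33\<close> times \<open>E12\<close>, \<open>E23\<close>
  or \<open>E13\<close>, on either side, is zero or strictly upper triangular. This is what makes
  cochains with such values cocycles.\<close>

lemma diagonal_class_annihilated:
  assumes "i = 1 \<or> i = 3"
  shows "lact (mat_of a) (unit_class i i) = (if a = One then unit_class i i else 0)"
    and "ract (unit_class i i) (mat_of a) = (if a = One then unit_class i i else 0)"
proof -
  have x: "lact (unit_mat 1 2) (unit_class i i) = 0" "lact (unit_mat 2 3) (unit_class i i) = 0"
    "ract (unit_class i i) (unit_mat 1 2) = 0" "ract (unit_class i i) (unit_mat 2 3) = 0"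
    using assms by (auto intro!: MmodN_eqI)
  show "lact (mat_of a) (unit_class i i) = (if a = One then unit_class i i else 0)"
    by (cases a) (simp_all add: x unit_mat_13 lact_mult unit_mat_in_N3)
  show "ract (unit_class i i) (mat_of a) = (if a = One then unit_class i i else 0)"
    by (cases a) (simp_all add: x unit_mat_13 ract_mult unit_mat_in_N3)
qed

section \<open>The Hochschild differential on matrices and on words\<close>

text \<open>The Hochschild differential without its term \<open>x\<^sub>1 f(x\<^sub>2, \<dots>)\<close>. Freezing the first
  argument turns it into a recursion on the list.\<close>
fun mat_T :: "(('r::comm_ring_1) mat3 list \<Rightarrow> 'r MmodN) \<Rightarrow> 'r mat3 list \<Rightarrow> 'r MmodN" where
  "mat_T f [] = 0"
| "mat_T f [x] = - ract (f []) x"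
| "mat_T f (x # y # r) = - f ((x ** y) # r) - mat_T (\<lambda>s. f (x # s)) (y # r)"

fun mat_D :: "(('r::comm_ring_1) mat3 list \<Rightarrow> 'r MmodN) \<Rightarrow> 'r mat3 list \<Rightarrow> 'r MmodN" where
  "mat_D f [] = 0"
| "mat_D f (x # r) = lact x (f r) + mat_T f (x # r)"

text \<open>Splitting off the term i = 0 lowers every remaining exponent of -1 by one, which is the
  minus sign in the recursion of \<open>mat_T\<close>.\<close>

lemma hoch_inner_eq_mat_T:
  "length xs = Suc n \<Longrightarrow>
     (\<Sum>i<n. qscale ((-1) ^ (i + 1)) (f (take i xs @ (xs ! i ** xs ! (i + 1)) # drop (i + 2) xs)))
     + qscale ((-1) ^ (n + 1)) (ract (f (take n xs)) (xs ! n)) = mat_T f xs"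
proof (induction n arbitrary: f xs)
  case 0
  then obtain x where "xs = [x]" by (auto simp: length_Suc_conv)
  then show ?case by simp
next
  case (Suc n)
  then obtain x y r where xs: "xs = x # y # r" "length (y # r) = Suc n"
    by (auto simp: length_Suc_conv)
  show ?case
    using Suc.IH[OF xs(2), of "\<lambda>s. f (x # s)"]
    unfolding xs(1) sum.lessThan_Suc_shift
    by (simp add: sum_negf algebra_simps eq_neg_iff_add_eq_0 neg_eq_iff_add_eq_0)
qed

lemma hoch_d_eq_mat_D:
  "hoch_d n f xs = (if valid_args (Suc n) xs then mat_D f xs else 0)"
proof (cases "valid_args (Suc n) xs")
  case True
  then obtain x r where xs: "xs = x # r" "length xs = Suc n"
    by (auto simp: valid_args_def length_Suc_conv)
  have "hoch_d n f xs = lact (xs ! 0) (f (tl xs)) + mat_T f xs"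
    using True hoch_inner_eq_mat_T[OF xs(2), of f] by (simp add: hoch_d_def add.assoc)
  then show ?thesis using True xs by simp
qed (simp add: hoch_d_def)

lemma mat_T_cong:
  "(\<And>s. Suc (length s) = length xs \<Longrightarrow> f s = g s) \<Longrightarrow> mat_T f xs = mat_T g xs"
proof (induction xs arbitrary: f g rule: induct_list012)
  case (3 x y r)
  have "mat_T (\<lambda>s. f (x # s)) (y # r) = mat_T (\<lambda>s. g (x # s)) (y # r)"
    by (rule 3(2)) (simp add: 3(3))
  then show ?case using 3(3) by simp
qed auto

lemma mat_T_cong_nonempty:
  assumes "\<And>s. s \<noteq> [] \<Longrightarrow> f s = g s"
  shows "mat_T f (a # b # xs) = mat_T g (a # b # xs)"
  by (rule mat_T_cong, rule assms) auto

lemma mat_T_add: "mat_T (\<lambda>s. f s + g s) xs = mat_T f xs + mat_T g xs"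
  by (induction xs arbitrary: f g rule: induct_list012) (simp_all add: ract_add)

lemma mat_T_minus: "mat_T (\<lambda>s. - f s) xs = - mat_T f xs"
  by (induction xs arbitrary: f rule: induct_list012) (simp_all)

lemma mat_T_lact:
  "a \<in> N3 \<Longrightarrow> set xs \<subseteq> N3 \<Longrightarrow> mat_T (\<lambda>s. lact a (f s)) xs = lact a (mat_T f xs)"
  by (induction xs arbitrary: f rule: induct_list012) (simp_all add: lact_ract lact_diff)

text \<open>\<open>mat_T\<close> is the Hochschild differential for the zero left action, so it
  squares to zero by associativity alone. Treating this part separately keeps the left action out of
  the induction.\<close>

lemma mat_T_mat_T:
  "set xs \<subseteq> N3 \<Longrightarrow> 2 \<le> length xs \<Longrightarrow> mat_T (mat_T f) xs = 0"
proof (induction xs arbitrary: f rule: induct_list012)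
  case (3 a b r)
  show ?case
  proof (cases r)
    case Nil
    with 3(3) show ?thesis by (simp add: ract_mult)
  next
    case (Cons c t)
    let ?fa = "\<lambda>s. f (a # s)"
    let ?G = "\<lambda>s. - f ((a ** hd s) # tl s)"
    have "mat_T (\<lambda>s. mat_T f (a # s)) (b # c # t) = mat_T (\<lambda>s. ?G s + - mat_T ?fa s) (b # c # t)"
      by (rule mat_T_cong_nonempty) (auto simp: neq_Nil_conv)
    also have "\<dots> = mat_T ?G (b # c # t) - mat_T (mat_T ?fa) (b # c # t)"
      unfolding mat_T_add mat_T_minus by simp
    also have "mat_T (mat_T ?fa) (b # c # t) = 0"
      using 3(2)[of ?fa] 3(3) Cons by simp
    also have "mat_T ?G (b # c # t) = f ((a ** (b ** c)) # t) + mat_T (\<lambda>s. f ((a ** b) # s)) (c # t)"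
      by (simp add: mat_T_minus)
    finally show ?thesis using Cons by (simp add: matrix_mul_assoc)
  qed
qed auto

lemma mat_D_mat_D:
  assumes "set xs \<subseteq> N3" "2 \<le> length xs"
  shows "mat_D (mat_D f) xs = 0"
proof -
  obtain a b r where xs: "xs = a # b # r"
    using assms(2) by (cases xs; cases "tl xs") auto
  let ?L = "\<lambda>s. lact (hd s) (f (tl s))"
  have "mat_T (mat_D f) xs = mat_T (\<lambda>s. ?L s + mat_T f s) xs"
    unfolding xs by (rule mat_T_cong_nonempty) (auto simp: neq_Nil_conv)
  also have "\<dots> = mat_T ?L xs"
    using mat_T_mat_T[OF assms] by (simp add: mat_T_add)
  also have "\<dots> = - lact (a ** b) (f r) - lact a (mat_T f (b # r))"
    using assms(1) mat_T_lact[of a "b # r" f] by (simp add: xs)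
  finally show ?thesis
    using assms(1) unfolding xs by (simp add: lact_add lact_mult)
qed

section \<open>The differential in terms of basis words\<close>

fun app_opt :: "(letter list \<Rightarrow> ('r::comm_ring_1) MmodN) \<Rightarrow> letter option \<Rightarrow> letter list \<Rightarrow> 'r MmodN" where
  "app_opt c None r = 0"
| "app_opt c (Some p) r = c (p # r)"

fun word_T :: "(letter list \<Rightarrow> ('r::comm_ring_1) MmodN) \<Rightarrow> letter list \<Rightarrow> 'r MmodN" where
  "word_T c [] = 0"
| "word_T c [a] = - ract (c []) (mat_of a)"
| "word_T c (a # b # r) = - app_opt c (mul a b) r - word_T (\<lambda>s. c (a # s)) (b # r)"

fun word_D :: "(letter list \<Rightarrow> ('r::comm_ring_1) MmodN) \<Rightarrow> letter list \<Rightarrow> 'r MmodN" where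
  "word_D c [] = 0"
| "word_D c (a # r) = lact (mat_of a) (c r) + word_T c (a # r)"

lemma app_opt_add: "app_opt (\<lambda>s. c s + d s) p r = app_opt c p r + app_opt d p r"
  by (cases p) simp_all

lemma app_opt_qscale: "app_opt (\<lambda>s. qscale k (c s)) p r = qscale k (app_opt c p r)"
  by (cases p) simp_all

lemma word_T_zero [simp]: "word_T (\<lambda>s. 0) ws = 0"
proof (induction ws rule: induct_list012)
  case (3 a b r)
  then show ?case by (cases "mul a b") simp_all
qed simp_all

lemma word_T_add: "word_T (\<lambda>s. c s + d s) ws = word_T c ws + word_T d ws"
  by (induction ws arbitrary: c d rule: induct_list012) (simp_all add: app_opt_add ract_add)

lemma word_T_qscale: "word_T (\<lambda>s. qscale k (c s)) ws = qscale k (word_T c ws)"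
  by (induction ws arbitrary: c rule: induct_list012)
    (simp_all add: app_opt_qscale ract_qscale qscale_diff_right)

lemma word_D_add: "word_D (\<lambda>s. c s + d s) ws = word_D c ws + word_D d ws"
  by (cases ws) (simp_all add: word_T_add lact_add algebra_simps)

lemma word_D_qscale: "word_D (\<lambda>s. qscale k (c s)) ws = qscale k (word_D c ws)"
  by (cases ws) (simp_all add: word_T_qscale lact_qscale qscale_add_right)

lemma word_D_zero [simp]: "word_D (\<lambda>s. 0) ws = 0"
  by (cases ws) simp_all

lemma word_D_diff: "word_D (\<lambda>s. c s - d s) ws = word_D c ws - word_D d ws"
  using word_D_add[of "\<lambda>s. c s - d s" d ws] by (simp add: eq_diff_eq)

lemma word_T_cong:
  "(\<And>s. Suc (length s) = length ws \<Longrightarrow> c s = d s) \<Longrightarrow> word_T c ws = word_T d ws"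
proof (induction ws arbitrary: c d rule: induct_list012)
  case (3 x y r)
  have "word_T (\<lambda>s. c (x # s)) (y # r) = word_T (\<lambda>s. d (x # s)) (y # r)"
    by (rule 3(2)) (simp add: 3(3))
  then show ?case using 3(3) by (cases "mul x y") simp_all
qed auto

lemma word_D_cong:
  "(\<And>s. Suc (length s) = length ws \<Longrightarrow> c s = d s) \<Longrightarrow> word_D c ws = word_D d ws"
  using word_T_cong[of ws c d] by (cases ws) auto

section \<open>Multilinear extension\<close>

definition lin :: "(('r::comm_ring_1) mat3 \<Rightarrow> 'r MmodN) \<Rightarrow> bool" where
  "lin h \<longleftrightarrow> (\<forall>x\<in>N3. \<forall>y\<in>N3. h (x + y) = h x + h y) \<and> (\<forall>c. \<forall>x\<in>N3. h (smat c x) = qscale c (h x))"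

text \<open>Recursion on the first argument matches the recursion of \<open>mat_T\<close>, which
  freezes that argument; the symmetric form in the definition of cochains does not induct
  well.\<close>

fun multilin :: "nat \<Rightarrow> (('r::comm_ring_1) mat3 list \<Rightarrow> 'r MmodN) \<Rightarrow> bool" where
  "multilin 0 f \<longleftrightarrow> True"
| "multilin (Suc n) f \<longleftrightarrow> (\<forall>r. valid_args n r \<longrightarrow> lin (\<lambda>x. f (x # r)))
     \<and> (\<forall>x\<in>N3. multilin n (\<lambda>r. f (x # r)))"

lemma multilin_iff:
  "multilin n f \<longleftrightarrow>
     (\<forall>xs ys x y c. length xs + length ys + 1 = n \<and> set xs \<subseteq> N3 \<and> set ys \<subseteq> N3
        \<and> x \<in> N3 \<and> y \<in> N3 \<longrightarrow>
          f (xs @ (x + y) # ys) = f (xs @ x # ys) + f (xs @ y # ys) \<and>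
          f (xs @ smat c x # ys) = qscale c (f (xs @ x # ys)))"
proof (induction n arbitrary: f)
  case 0
  then show ?case by simp
next
  case (Suc n)
  show ?case (is "?L \<longleftrightarrow> ?R")
  proof
    assume L: ?L
    show ?R
    proof (intro allI impI)
      fix xs ys :: "'a mat3 list" and x y :: "'a mat3" and c
      assume A: "length xs + length ys + 1 = Suc n \<and> set xs \<subseteq> N3 \<and> set ys \<subseteq> N3
        \<and> x \<in> N3 \<and> y \<in> N3"
      show "f (xs @ (x + y) # ys) = f (xs @ x # ys) + f (xs @ y # ys) \<and>
          f (xs @ smat c x # ys) = qscale c (f (xs @ x # ys))"
      proof (cases xs)
        case Nil
        with L A show ?thesis by (simp add: lin_def valid_args_def)
      next
        case (Cons z zs)
        then have "multilin n (\<lambda>r. f (z # r))" using L A by auto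
        from this[unfolded Suc.IH, rule_format, of zs ys x y c] show ?thesis
          using A Cons by auto
      qed
    qed
  next
    assume R: ?R
    have "lin (\<lambda>x. f (x # r))" if "valid_args n r" for r
      using R[rule_format, of "[]" r] that N3_zero by (auto simp: lin_def valid_args_def)
    moreover have "multilin n (\<lambda>r. f (z # r))" if "z \<in> N3" for z
      unfolding Suc.IH
    proof (intro allI impI)
      fix xs ys :: "'a mat3 list" and x y :: "'a mat3" and c
      assume A: "length xs + length ys + 1 = n \<and> set xs \<subseteq> N3 \<and> set ys \<subseteq> N3
        \<and> x \<in> N3 \<and> y \<in> N3"
      show "f (z # xs @ (x + y) # ys) = f (z # xs @ x # ys) + f (z # xs @ y # ys) \<and>
          f (z # xs @ smat c x # ys) = qscale c (f (z # xs @ x # ys))"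
        using R[rule_format, of "z # xs" ys x y c] A that by simp
    qed
    ultimately show ?L by simp
  qed
qed

lemma hoch_cochains_iff:
  "f \<in> hoch_cochains n \<longleftrightarrow> (\<forall>xs. \<not> valid_args n xs \<longrightarrow> f xs = 0) \<and> multilin n f"
  by (simp only: hoch_cochains_def multilin_iff mem_Collect_eq)

lemma valid_args_0 [simp]: "valid_args 0 xs \<longleftrightarrow> xs = []"
  by (auto simp: valid_args_def)

lemma valid_args_Nil [simp]: "valid_args n [] \<longleftrightarrow> n = 0"
  by (auto simp: valid_args_def)

lemma valid_args_Suc_Cons [simp]:
  "valid_args (Suc n) (x # xs) \<longleftrightarrow> x \<in> N3 \<and> valid_args n xs"
  by (auto simp: valid_args_def)

lemma valid_args_map_mat_of [simp]: "valid_args n (map mat_of ws) \<longleftrightarrow> length ws = n"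
  by (auto simp: valid_args_def)

lemma multilin_cong:
  "(\<And>xs. valid_args n xs \<Longrightarrow> f xs = g xs) \<Longrightarrow> multilin n f \<longleftrightarrow> multilin n g"
proof (induction n arbitrary: f g)
  case (Suc n)
  have "lin (\<lambda>x. f (x # r)) \<longleftrightarrow> lin (\<lambda>x. g (x # r))" if "valid_args n r" for r
    using Suc.prems that by (auto simp: lin_def N3_add smat_in_N3)
  moreover have "multilin n (\<lambda>r. f (x # r)) \<longleftrightarrow> multilin n (\<lambda>r. g (x # r))" if "x \<in> N3" for x
    by (rule Suc.IH) (simp add: Suc.prems that)
  ultimately show ?case by auto
qed simp

lemma lin_add: "lin f \<Longrightarrow> lin g \<Longrightarrow> lin (\<lambda>x. f x + g x)"
  by (simp add: lin_def qscale_add_right algebra_simps)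

lemma lin_diff: "lin f \<Longrightarrow> lin g \<Longrightarrow> lin (\<lambda>x. f x - g x)"
  by (simp add: lin_def qscale_diff_right algebra_simps)

lemma lin_minus: "lin f \<Longrightarrow> lin (\<lambda>x. - f x)"
  by (simp add: lin_def)

lemma lin_qscale: "lin f \<Longrightarrow> lin (\<lambda>x. qscale c (f x))"
  by (simp add: lin_def qscale_add_right flip: qscale_mult) (simp add: mult.commute)

lemma multilin_zero: "multilin n (\<lambda>xs. 0)"
  by (induction n) (simp_all add: lin_def)

lemma multilin_add: "multilin n f \<Longrightarrow> multilin n g \<Longrightarrow> multilin n (\<lambda>xs. f xs + g xs)"
  by (induction n arbitrary: f g) (simp_all add: lin_add)

lemma multilin_minus: "multilin n f \<Longrightarrow> multilin n (\<lambda>xs. - f xs)"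
  by (induction n arbitrary: f) (simp_all add: lin_minus)

lemma multilin_diff: "multilin n f \<Longrightarrow> multilin n g \<Longrightarrow> multilin n (\<lambda>xs. f xs - g xs)"
  by (induction n arbitrary: f g) (simp_all add: lin_diff)

lemma multilin_qscale: "multilin n f \<Longrightarrow> multilin n (\<lambda>xs. qscale c (f xs))"
  by (induction n arbitrary: f) (simp_all add: lin_qscale)

lemma multilin_lact: "a \<in> N3 \<Longrightarrow> multilin n f \<Longrightarrow> multilin n (\<lambda>xs. lact a (f xs))"
  by (induction n arbitrary: f) (simp_all add: lin_def lact_add lact_qscale)

lemma lin_ract: "lin h \<Longrightarrow> lin (\<lambda>x. ract (h x) a)"
  by (simp add: lin_def ract_add ract_qscale)

lemma lin_mult_left:
  assumes "lin h" "a \<in> N3"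
  shows "lin (\<lambda>x. h (a ** x))"
proof -
  have "a ** smat c x = smat c (a ** x)" for c x
    by (simp add: smat_def vec_eq_iff matrix_matrix_mult_def sum_3 algebra_simps)
  then show ?thesis
    using assms by (simp add: lin_def N3_mult matrix_add_ldistrib)
qed

lemma lin_mult_right:
  assumes "lin h" "a \<in> N3"
  shows "lin (\<lambda>x. h (x ** a))"
proof -
  have "smat c x ** a = smat c (x ** a)" "(x + y) ** a = x ** a + y ** a" for c x y
    by (simp_all add: smat_def vec_eq_iff matrix_matrix_mult_def sum_3 algebra_simps)
  then show ?thesis
    using assms by (simp add: lin_def N3_mult)
qed

lemma lin_mat_T:
  "(\<And>s. valid_args n s \<Longrightarrow> lin (\<lambda>x. F x s)) \<Longrightarrow> valid_args (Suc n) xs \<Longrightarrow> lin (\<lambda>x. mat_T (F x) xs)"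
proof (induction xs arbitrary: n F rule: induct_list012)
  case (2 y)
  then show ?case by (simp add: lin_minus lin_ract)
next
  case (3 a b r)
  then obtain m where m: "n = Suc m" by (cases n) auto
  have "lin (\<lambda>x. mat_T (\<lambda>s. F x (a # s)) (b # r))"
    by (rule 3(2)[of m]) (use 3(3,4) m in auto)
  moreover have "lin (\<lambda>x. F x ((a ** b) # r))"
    by (rule 3(3)) (use 3(4) m in \<open>auto simp: N3_mult\<close>)
  ultimately show ?case by (simp add: lin_minus lin_diff)
qed simp

lemma multilin_mat_T: "multilin n f \<Longrightarrow> multilin (Suc n) (mat_T f)"
proof (induction n arbitrary: f)
  case 0
  then show ?case by (simp add: lin_def ract_add_right ract_smat)
next
  case (Suc n)
  have f: "lin (\<lambda>x. f (x # s))" if "valid_args n s" for s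
    using Suc.prems that by simp
  have head: "lin (\<lambda>x. mat_T f (x # r))" if r: "valid_args (Suc n) r" for r
  proof -
    obtain y t where yt: "r = y # t" "y \<in> N3" "valid_args n t"
      using r by (cases r) auto
    have "lin (\<lambda>x. mat_T (\<lambda>s. f (x # s)) (y # t))"
      by (rule lin_mat_T[of n]) (use f yt in auto)
    then show ?thesis
      unfolding yt(1) using lin_mult_right[OF f[OF yt(3)] yt(2)] by (simp add: lin_diff lin_minus)
  qed
  have tail: "multilin (Suc n) (\<lambda>r. mat_T f (x # r))" if x: "x \<in> N3" for x
  proof -
    \<comment> \<open>Through \<open>hd\<close> and \<open>tl\<close> the product term becomes a
      function of the whole list; valid lists are nonempty here, so \<open>multilin_cong\<close> can
      later restore the pattern form.\<close>
    have "multilin (Suc n) (\<lambda>r. f ((x ** hd r) # tl r))"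
      using Suc.prems x lin_mult_left[OF f x] by (simp add: N3_mult)
    moreover have "multilin (Suc n) (mat_T (\<lambda>s. f (x # s)))"
      by (rule Suc.IH) (use Suc.prems x in simp)
    ultimately have "multilin (Suc n) (\<lambda>r. - f ((x ** hd r) # tl r) - mat_T (\<lambda>s. f (x # s)) r)"
      by (intro multilin_diff multilin_minus)
    then show ?thesis
      by (rule iffD1[OF multilin_cong, rotated]) (auto simp: valid_args_def length_Suc_conv)
  qed
  show ?case using head tail by simp
qed

lemma multilin_mat_D:
  assumes "multilin n f"
  shows "multilin (Suc n) (mat_D f)"
proof -
  have "multilin (Suc n) (\<lambda>r. lact (hd r) (f (tl r)))"
    using assms by (simp add: lin_def lact_add_left lact_smat multilin_lact)
  then have "multilin (Suc n) (\<lambda>r. lact (hd r) (f (tl r)) + mat_T f r)"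
    by (intro multilin_add multilin_mat_T assms)
  then show ?thesis
    by (rule iffD1[OF multilin_cong, rotated]) (auto simp: valid_args_def length_Suc_conv)
qed

lemma hoch_d_in_cochains:
  assumes "f \<in> hoch_cochains n"
  shows "hoch_d n f \<in> hoch_cochains (Suc n)"
proof -
  have "multilin (Suc n) (mat_D f)"
    using assms by (intro multilin_mat_D) (simp add: hoch_cochains_iff)
  then have "multilin (Suc n) (hoch_d n f)"
    by (rule iffD1[OF multilin_cong, rotated]) (simp add: hoch_d_eq_mat_D)
  then show ?thesis by (simp add: hoch_cochains_iff hoch_d_eq_mat_D)
qed

text \<open>Additivity forces the value 0 at an entry 0, which is the value that
  \<open>app_opt\<close> gives to \<open>None\<close>.\<close>

lemma app_opt_mul:
  assumes "lin (\<lambda>x. f (x # map mat_of r))"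
  shows "f ((mat_of a ** mat_of b) # map mat_of r) = app_opt (\<lambda>ws. f (map mat_of ws)) (mul a b) r"
proof -
  have "f (0 # map mat_of r) = 0"
    using assms N3_zero unfolding lin_def by (metis add_cancel_right_right add_0)
  then show ?thesis by (simp add: mat_of_mult split: option.split)
qed

lemma mat_T_words:
  "multilin n f \<Longrightarrow> length ws = Suc n \<Longrightarrow>
     mat_T f (map mat_of ws) = word_T (\<lambda>ws. f (map mat_of ws)) ws"
proof (induction ws arbitrary: n f rule: induct_list012)
  case (3 a b r)
  then obtain m where m: "n = Suc m" by auto
  have "lin (\<lambda>x. f (x # map mat_of r))"
    using 3 m by simp
  from app_opt_mul[OF this] 3(2)[of m "\<lambda>s. f (mat_of a # s)"] 3(3,4) m show ?case by simp
qed simp_all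

lemma mat_D_words:
  assumes "multilin n f" "length ws = Suc n"
  shows "mat_D f (map mat_of ws) = word_D (\<lambda>ws. f (map mat_of ws)) ws"
  using mat_T_words[OF assms] assms(2) by (cases ws) auto

fun ext :: "(letter list \<Rightarrow> ('r::comm_ring_1) MmodN) \<Rightarrow> 'r mat3 list \<Rightarrow> 'r MmodN" where
  "ext c [] = c []"
| "ext c (x # xs) = qscale (coord One x) (ext (\<lambda>s. c (One # s)) xs)
     + qscale (coord X x) (ext (\<lambda>s. c (X # s)) xs)
     + qscale (coord Y x) (ext (\<lambda>s. c (Y # s)) xs)
     + qscale (coord Z x) (ext (\<lambda>s. c (Z # s)) xs)"

lemma multilin_ext: "multilin n (ext c)"
proof (induction n arbitrary: c)
  case (Suc n)
  show ?case
    using Suc by (simp add: lin_def qscale_add_left qscale_add_right qscale_mult multilin_add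
        multilin_qscale del: coord.simps)
qed simp

lemma ext_words [simp]: "ext c (map mat_of ws) = c ws"
proof (induction ws arbitrary: c)
  case (Cons a ws)
  then show ?case by (cases a) (simp_all del: coord.simps mat_of.simps)
qed simp

lemma multilin_eq_ext:
  "multilin n f \<Longrightarrow> valid_args n xs \<Longrightarrow> f xs = ext (\<lambda>ws. f (map mat_of ws)) xs"
proof (induction n arbitrary: f xs)
  case (Suc n)
  then obtain x r where xs: "xs = x # r" "x \<in> N3" "valid_args n r"
    by (cases xs) auto
  have h: "lin (\<lambda>x. f (x # r))" using Suc.prems xs by simp
  have IH: "ext (\<lambda>s. f (mat_of a # map mat_of s)) r = f (mat_of a # r)" for a
    using Suc.IH[of "\<lambda>s. f (mat_of a # s)" r] Suc.prems xs by simp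
  have "f (x # r) = f ((smat (coord One x) (mat_of One) + smat (coord X x) (mat_of X)
    + smat (coord Y x) (mat_of Y) + smat (coord Z x) (mat_of Z)) # r)"
    using N3_expand[OF xs(2)] by simp
  also have "\<dots> = qscale (coord One x) (f (mat_of One # r)) + qscale (coord X x) (f (mat_of X # r))
    + qscale (coord Y x) (f (mat_of Y # r)) + qscale (coord Z x) (f (mat_of Z # r))"
    using h unfolding lin_def
    by (simp add: N3_add smat_in_N3 del: coord.simps mat_of.simps)
  finally show ?case
    by (simp add: xs(1) IH del: coord.simps mat_of.simps)
qed simp

section \<open>Cochains and cocycles as functions on words\<close>

definition cochain_of :: "nat \<Rightarrow> (letter list \<Rightarrow> ('r::comm_ring_1) MmodN) \<Rightarrow> 'r mat3 list \<Rightarrow> 'r MmodN" where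
  "cochain_of n c xs = (if valid_args n xs then ext c xs else 0)"

lemma cochain_of_in_cochains: "cochain_of n c \<in> hoch_cochains n"
proof -
  have "multilin n (cochain_of n c)"
    using multilin_ext[of n c] by (rule iffD1[OF multilin_cong, rotated]) (simp add: cochain_of_def)
  then show ?thesis by (simp add: hoch_cochains_iff cochain_of_def)
qed

lemma cochain_of_words: "length ws = n \<Longrightarrow> cochain_of n c (map mat_of ws) = c ws"
  by (simp add: cochain_of_def)

lemma hoch_cochains_eqI:
  assumes f: "f \<in> hoch_cochains n" and g: "g \<in> hoch_cochains n"
    and eq: "\<And>ws. length ws = n \<Longrightarrow> f (map mat_of ws) = g (map mat_of ws)"
  shows "f = g"
proof
  fix xs
  have "f xs - g xs = 0"
  proof (cases "valid_args n xs")
    case True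
    have ext0: "ext c ys = 0" if "valid_args m ys" "\<And>ws. length ws = m \<Longrightarrow> c ws = 0" for c ys m
      using that
    proof (induction ys arbitrary: c m)
      case (Cons y ys)
      then obtain k where k: "m = Suc k" by (cases m) auto
      have "ext (\<lambda>s. c (a # s)) ys = 0" for a
        by (rule Cons.IH[of k]) (use Cons.prems k in auto)
      then show ?case by simp
    qed simp
    have "f xs - g xs = ext (\<lambda>ws. f (map mat_of ws) - g (map mat_of ws)) xs"
      using multilin_eq_ext[OF multilin_diff True, of f g] f g by (simp add: hoch_cochains_iff)
    also have "\<dots> = 0" by (rule ext0[OF True]) (simp add: eq)
    finally show ?thesis .
  next
    case False
    then show ?thesis using f g by (simp add: hoch_cochains_iff)
  qed
  then show "f xs = g xs" by simp
qed

lemma hoch_d_words: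
  assumes "f \<in> hoch_cochains n" "length ws = Suc n"
  shows "hoch_d n f (map mat_of ws) = word_D (\<lambda>ws. f (map mat_of ws)) ws"
  using assms mat_D_words[of n f ws] by (simp add: hoch_d_eq_mat_D hoch_cochains_iff)

lemma hoch_cocycles_iff:
  "f \<in> hoch_cocycles n \<longleftrightarrow> f \<in> hoch_cochains n
     \<and> (\<forall>ws. length ws = Suc n \<longrightarrow> word_D (\<lambda>ws. f (map mat_of ws)) ws = 0)"
proof -
  have z: "(\<lambda>_. 0) \<in> hoch_cochains (Suc n)"
    by (simp add: hoch_cochains_iff multilin_zero)
  have "hoch_d n f = (\<lambda>_. 0) \<longleftrightarrow> (\<forall>ws. length ws = Suc n \<longrightarrow> word_D (\<lambda>ws. f (map mat_of ws)) ws = 0)"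
    if f: "f \<in> hoch_cochains n"
    using hoch_d_words[OF f] hoch_cochains_eqI[OF hoch_d_in_cochains[OF f] z] by fastforce
  then show ?thesis by (auto simp: hoch_cocycles_def)
qed

text \<open>Transferred from matrices: \<open>word_D\<close> describes \<open>mat_D\<close> on the
  multilinear extension, where associativity is that of the matrix product and \<open>None\<close>
  needs no bookkeeping.\<close>

lemma word_D_word_D:
  assumes "2 \<le> length ws"
  shows "word_D (word_D c) ws = 0"
proof -
  obtain n where n: "length ws = Suc (Suc n)"
    using assms by (metis Suc_le_D numeral_2_eq_2 Suc_le_mono)
  have "0 = mat_D (mat_D (ext c)) (map mat_of ws)"
    using assms by (subst mat_D_mat_D) (simp_all add: map_mat_of_in_N3 del: set_map)
  also have "\<dots> = word_D (\<lambda>ws. mat_D (ext c) (map mat_of ws)) ws"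
    by (rule mat_D_words[OF multilin_mat_D[OF multilin_ext] n])
  also have "\<dots> = word_D (word_D c) ws"
    by (rule word_D_cong) (simp add: n mat_D_words[OF multilin_ext])
  finally show ?thesis by simp
qed

section \<open>The Morse matching\<close>

datatype morse_kind = Crit | Low | Up

definition ones :: "letter list \<Rightarrow> nat" where
  "ones ws = length (takeWhile (\<lambda>a. a = One) ws)"

lemma ones_simps [simp]:
  "ones [] = 0" "ones (One # r) = Suc (ones r)" "a \<noteq> One \<Longrightarrow> ones (a # r) = 0"
  by (simp_all add: ones_def)

text \<open>Critical words are the words \<open>y\<^sup>i x\<^sup>j\<close>, the generators of the Koszul resolution. In any
  other word, let \<open>w\<close> be the longest critical prefix; the matching pairs \<open>[w|z|r]\<close> with
  \<open>[w|x|y|r]\<close>, and \<open>w\<close> followed by an odd number of units with one more unit inserted.\<close>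
fun kind :: "letter list \<Rightarrow> morse_kind" where
  "kind [] = Crit"
| "kind (One # r) = (if even (ones r) then Low else Up)"
| "kind (Z # r) = Low"
| "kind (Y # r) = kind r"
| "kind (X # Y # r) = Up"
| "kind (X # r) = kind r"

fun up :: "letter list \<Rightarrow> letter list" where
  "up [] = []"
| "up (One # r) = One # One # r"
| "up (Z # r) = X # Y # r"
| "up (Y # r) = Y # up r"
| "up (X # r) = X # up r"

text \<open>The coefficient of \<open>h u\<close> in \<open>word_D h (up u)\<close>: a minus for
  each letter \<open>X\<close> or \<open>Y\<close> in front, then plus for a doubled unit and minus
  for splitting z as xy.\<close>

fun low_sign :: "letter list \<Rightarrow> 'a \<Rightarrow> ('a :: ab_group_add)" where
  "low_sign (One # r) m = m"
| "low_sign (Z # r) m = - m"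
| "low_sign (a # r) m = - low_sign r m"
| "low_sign [] m = m"

lemma low_sign_zero [simp]: "low_sign u 0 = 0"
  by (induction u "0 :: 'a" rule: low_sign.induct) auto

lemma low_sign_minus [simp]: "low_sign u (- m) = - low_sign u m"
  by (induction u m rule: low_sign.induct) auto

lemma low_sign_idem [simp]: "low_sign u (low_sign u m) = m"
  by (induction u m rule: low_sign.induct) auto

lemma low_sign_eq_0 [simp]: "low_sign u m = 0 \<longleftrightarrow> m = 0"
  by (metis low_sign_idem low_sign_zero)

lemma kind_X: "kind (X # r) = (case r of Y # _ \<Rightarrow> Up | _ \<Rightarrow> kind r)"
  by (cases r rule: kind.cases) (auto split: list.split letter.split)

lemma length_up: "kind u = Low \<Longrightarrow> length (up u) = Suc (length u)"
  by (induction u rule: up.induct) (auto simp: kind_X split: list.splits letter.splits)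

lemma kind_up: "kind u = Low \<Longrightarrow> kind (up u) = Up"
  by (induction u rule: up.induct) (auto simp: kind_X split: list.splits letter.splits if_splits)

lemma Up_eq_up: "kind v = Up \<Longrightarrow> \<exists>u. kind u = Low \<and> v = up u"
proof (induction v rule: kind.induct)
  case (2 r)
  then obtain s where "r = One # s" "even (ones s)"
    by (cases r rule: kind.cases) (auto split: if_splits)
  then show ?case by (intro exI[of _ "One # s"]) simp
next
  case (4 r)
  then obtain u where "kind u = Low" "r = up u" by auto
  then show ?case by (intro exI[of _ "Y # u"]) simp
next
  case (5 r)
  show ?case by (intro exI[of _ "Z # r"]) simp
next
  case ("6_2" r)
  then obtain u where "kind u = Low" "One # r = up u" by auto
  \<comment> \<open>As \<open>up u\<close> begins with \<open>One\<close>, \<open>u\<close> does not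
    begin with \<open>Y\<close>, so the new \<open>X\<close> creates no factor xy.\<close>
  moreover from this have "kind (X # u) = Low" by (cases u rule: up.cases) (auto simp: kind_X)
  ultimately show ?case by (intro exI[of _ "X # u"]) simp
next
  case ("6_3" r)
  then obtain u where "kind u = Low" "X # r = up u" by auto
  moreover from this have "kind (X # u) = Low" by (cases u rule: up.cases) (auto simp: kind_X)
  ultimately show ?case by (intro exI[of _ "X # u"]) simp
qed auto

definition vanishes :: "(letter list \<Rightarrow> 'a::zero) \<Rightarrow> bool" where
  "vanishes h \<longleftrightarrow> (\<forall>ws. kind ws \<noteq> Low \<longrightarrow> h ws = 0)"

lemma vanishes_X: "vanishes h \<Longrightarrow> vanishes (\<lambda>s. h (X # s))"
  by (auto simp: vanishes_def kind_X split: list.splits letter.splits)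

lemma vanishes_Y: "vanishes h \<Longrightarrow> vanishes (\<lambda>s. h (Y # s))"
  by (auto simp: vanishes_def)

text \<open>A product whose left factor is not the unit is never the unit, so \<open>h\<close> is
  only evaluated at words without a leading unit.\<close>

lemma word_T_no_unit:
  assumes "b \<noteq> One" "\<And>s. ones s = 0 \<Longrightarrow> h s = 0"
  shows "word_T h (b # t) = 0"
proof (cases t)
  case (Cons a r)
  have "(\<lambda>s. h (b # s)) = (\<lambda>s. 0)" using assms by auto
  moreover have "app_opt h (mul b a) r = 0"
    using assms by (cases b; cases a) auto
  ultimately show ?thesis using Cons by simp
qed (use assms in simp)

text \<open>In a run of k units, the k products that absorb one of them give the same word with
  alternating signs and cancel, k being even. The remaining terms keep an even run, where
  \<open>h\<close> vanishes.\<close>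

lemma word_T_units:
  "even (ones r) \<Longrightarrow> (\<And>s. odd (ones s) \<Longrightarrow> h (One # s) = 0) \<Longrightarrow> word_T h (One # One # r) = 0"
proof (induction "ones r" arbitrary: r h rule: less_induct)
  case less
  show ?case
  proof (cases r)
    case (Cons b t)
    show ?thesis
    proof (cases "b = One")
      case True
      then obtain t' where t: "t = One # t'"
        using less.prems(1) Cons by (cases t; cases "hd t") auto
      have "word_T (\<lambda>s. h (One # One # s)) (One # One # t') = 0"
        by (rule less.hyps) (use less.prems Cons True t in auto)
      then show ?thesis using Cons True t by simp
    next
      case False
      have "word_T (\<lambda>s. h (One # One # s)) (b # t) = 0"
        by (rule word_T_no_unit[OF False]) (simp add: less.prems(2))
      then show ?thesis using Cons by simp
    qed
  qed simp
qed

text \<open>If \<open>r\<close> starts with a unit, so does \<open>up r\<close>, and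
  \<open>a\<close> absorbs it. Otherwise \<open>up r\<close> starts with \<open>X\<close> or
  \<open>Y\<close>, and its product with \<open>a\<close> is 0, since xy is excluded by
  \<open>kind (a # r) = Low\<close>.\<close>

lemma word_T_Cons_up:
  assumes "a = X \<or> a = Y" "kind (a # r) = Low"
  shows "word_T h (a # up r) =
    (case r of One # _ \<Rightarrow> - h (a # r) | _ \<Rightarrow> 0) - word_T (\<lambda>s. h (a # s)) (up r)"
proof -
  have k: "kind r = Low" using assms by (auto simp: kind_X split: list.splits letter.splits)
  then obtain b t where bt: "up r = b # t" by (cases r rule: up.cases) auto
  have "app_opt h (mul a b) t = (case r of One # _ \<Rightarrow> h (a # r) | _ \<Rightarrow> 0)"
    using assms bt by (cases r rule: up.cases) auto
  then show ?thesis unfolding bt by (simp split: list.split letter.split)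
qed

lemma word_T_up:
  "kind u = Low \<Longrightarrow> vanishes h \<Longrightarrow>
     word_T h (up u) = (case u of One # _ \<Rightarrow> 0 | _ \<Rightarrow> low_sign u (h u))"
proof (induction u arbitrary: h rule: up.induct)
  case (2 r)
  have "word_T h (One # One # r) = 0"
    by (rule word_T_units) (use 2 in \<open>auto simp: vanishes_def split: if_splits\<close>)
  then show ?case by (simp del: word_T.simps)
next
  case (3 r)
  have "(\<lambda>s. h (X # Y # s)) = (\<lambda>s. 0)" using 3 by (auto simp: vanishes_def)
  moreover have "h (X # Y # s) = 0" "h [X] = 0" for s using 3 by (auto simp: vanishes_def)
  ultimately have "word_T (\<lambda>s. h (X # s)) (Y # r) = 0"
    by (cases r; cases "hd r") simp_all
  then show ?case by simp
next
  case (4 r)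
  have IH: "word_T (\<lambda>s. h (Y # s)) (up r) = (case r of One # _ \<Rightarrow> 0 | _ \<Rightarrow> low_sign r (h (Y # r)))"
    using 4 by (intro 4(1)) (auto intro: vanishes_Y)
  show ?case
    unfolding up.simps word_T_Cons_up[OF disjI2[OF refl] 4(2)] IH
    by (simp split: list.split letter.split)
next
  case (5 r)
  have k: "kind r = Low" using 5(2) by (auto simp: kind_X split: list.splits letter.splits)
  have IH: "word_T (\<lambda>s. h (X # s)) (up r) = (case r of One # _ \<Rightarrow> 0 | _ \<Rightarrow> low_sign r (h (X # r)))"
    using 5 k by (intro 5(1)) (auto intro: vanishes_X)
  show ?case
    unfolding up.simps word_T_Cons_up[OF disjI1[OF refl] 5(2)] IH
    by (simp split: list.split letter.split)
qed simp

text \<open>The left action contributes h at \<open>up u\<close> without its first letter. This is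
  again in the image of \<open>up\<close>, hence 0, unless \<open>u\<close> starts with
  \<open>One\<close>, where it is the main term, or with \<open>Z\<close>, where it is the one
  correction that prevents a diagonal system.\<close>

lemma word_D_up:
  assumes "kind u = Low" "vanishes h"
  shows "word_D h (up u) =
    low_sign u (h u) + (case u of Z # r \<Rightarrow> lact (mat_of X) (h (Y # r)) | _ \<Rightarrow> 0)"
proof -
  have *: "h (up r) = 0" if "kind r = Low" for r
    using assms(2) kind_up[OF that] by (simp add: vanishes_def)
  note T = word_T_up[OF assms]
  show ?thesis
  proof (cases u rule: up.cases)
    case 1
    then show ?thesis using assms(1) by simp
  next
    case (2 r)
    show ?thesis using T unfolding 2 up.simps word_D.simps by (simp del: word_T.simps)
  next
    case (3 r)
    show ?thesis using T unfolding 3 up.simps word_D.simps by (simp del: word_T.simps)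
  next
    case (4 r)
    have "kind r = Low" using assms(1) 4 by simp
    from *[OF this] show ?thesis
      using T unfolding 4 up.simps word_D.simps by (simp del: word_T.simps)
  next
    case (5 r)
    have "kind r = Low"
      using assms(1) unfolding 5 kind_X by (simp split: list.splits letter.splits)
    from *[OF this] show ?thesis
      using T unfolding 5 up.simps word_D.simps by (simp del: word_T.simps)
  qed
qed

text \<open>Neighbouring letters of a critical word multiply to 0, so only the right action
  survives.\<close>

lemma word_T_Crit:
  "kind ws = Crit \<Longrightarrow> ws \<noteq> [] \<Longrightarrow>
     word_T c ws = qscale ((-1) ^ length ws) (ract (c (butlast ws)) (mat_of (last ws)))"
proof (induction ws arbitrary: c rule: induct_list012)
  case (3 a b r)
  have "kind (b # r) = Crit" "mul a b = None"
    using 3(3) by (cases a; cases b; auto split: if_splits)+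
  then show ?case using 3(2)[of "\<lambda>s. c (a # s)"] by simp
qed simp_all

lemma word_D_Crit:
  assumes "kind ws = Crit" "ws \<noteq> []"
  shows "word_D c ws = lact (mat_of (hd ws)) (c (tl ws))
    + qscale ((-1) ^ length ws) (ract (c (butlast ws)) (mat_of (last ws)))"
  using word_T_Crit[OF assms, of c] assms(2) by (cases ws) auto

lemma kind_tl: "kind ws = Crit \<Longrightarrow> kind (tl ws) = Crit"
  by (cases ws rule: kind.cases) (auto split: if_splits)

lemma kind_butlast: "kind ws = Crit \<Longrightarrow> kind (butlast ws) = Crit"
proof (induction ws rule: kind.induct)
  case ("6_3" r)
  then show ?case by (cases r) (auto simp: kind_X split: if_splits list.splits letter.splits)
qed (auto split: if_splits)

text \<open>A first cochain \<open>g\<close> corrects \<open>c\<close> on the words of kind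
  \<open>Up\<close>; what is left lives on the words of kind \<open>Low\<close>, and the cocycle
  condition at the partners \<open>up u\<close> then kills it.\<close>

lemma word_cocycle_vanishing_on_Crit:
  assumes cocycle: "\<And>ws. length ws = Suc (Suc m) \<Longrightarrow> word_D c ws = 0"
    and crit: "\<And>ws. length ws = Suc m \<Longrightarrow> kind ws = Crit \<Longrightarrow> c ws = 0"
  shows "\<exists>g. \<forall>ws. length ws = Suc m \<longrightarrow> c ws = word_D g ws"
proof -
  \<comment> \<open>The system given by \<open>word_D_up\<close> is solved in two passes: a word
    starting with \<open>Z\<close> involves only one starting with \<open>Y\<close>, whose value
    \<open>g0\<close> already settles.\<close>
  define g0 where "g0 u = (if kind u = Low then low_sign u (c (up u)) else 0)" for u
  define g where "g u = (case u of
      Z # r \<Rightarrow> low_sign u (c (up u) - lact (mat_of X) (g0 (Y # r))) | _ \<Rightarrow> g0 u)" for u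
  have van_g: "vanishes g"
    by (auto simp: vanishes_def g_def g0_def split: list.split letter.split)
  have g: "word_D g (up u) = c (up u)" if "kind u = Low" for u
    unfolding word_D_up[OF that van_g] using that
    by (auto simp: g_def g0_def split: list.split letter.split)
  \<comment> \<open>The value 0 at other lengths is what lets \<open>vanishes h\<close> hold for all
    words, although \<open>c\<close> is controlled in one degree only.\<close>
  define h where "h ws = (if length ws = Suc m then c ws - word_D g ws else 0)" for ws
  have h_Crit: "h ws = 0" if k: "kind ws = Crit" for ws
  proof (cases "length ws = Suc m")
    case True
    then have "word_D g ws = 0"
      using van_g kind_tl[OF k] kind_butlast[OF k]
      by (subst word_D_Crit[OF k]) (auto simp: vanishes_def)
    then show ?thesis using crit[OF True k] by (simp add: h_def)
  qed (simp add: h_def)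
  have h_Up: "h ws = 0" if "kind ws = Up" for ws
    using Up_eq_up[OF that] g by (auto simp: h_def)
  have van_h: "vanishes h"
    using h_Crit h_Up morse_kind.exhaust unfolding vanishes_def by blast
  have Dh: "word_D h ws = 0" if l: "length ws = Suc (Suc m)" for ws
  proof -
    have "word_D h ws = word_D (\<lambda>s. c s - word_D g s) ws"
      by (rule word_D_cong) (simp add: l h_def)
    also have "\<dots> = 0"
      using cocycle[OF l] word_D_word_D[of ws g] l by (simp add: word_D_diff)
    finally show ?thesis .
  qed
  have low: "low_sign u (h u) + (case u of Z # r \<Rightarrow> lact (mat_of X) (h (Y # r)) | _ \<Rightarrow> 0) = 0"
    if "kind u = Low" "length u = Suc m" for u
    using Dh[of "up u"] word_D_up[OF that(1) van_h] length_up[OF that(1)] that(2) by simp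
  \<comment> \<open>Words starting with \<open>Y\<close> come first, as they are the correction
    terms for words starting with \<open>Z\<close>.\<close>
  have h_Y: "h (Y # r) = 0" if "length r = m" for r
    using low[of "Y # r"] that h_Crit[of "Y # r"] h_Up[of "Y # r"] by (cases "kind r") auto
  have "h u = 0" if l: "length u = Suc m" for u
  proof (cases "kind u")
    case Low
    show ?thesis
      using low[OF Low l] l h_Y by (auto split: list.splits letter.splits)
  qed (simp_all add: h_Crit h_Up)
  then show ?thesis by (intro exI[of _ g]) (simp add: h_def)
qed

text \<open>A term can hit \<open>w\<close> only if the word is \<open>w\<close> with a unit
  inserted, because z does not occur in \<open>w\<close>. The two ways of absorbing that unit have
  opposite signs; for a unit in front, one of them is the left action, which \<open>word_T\<close>
  omits.\<close>

lemma word_D_delta_aux: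
  assumes v: "\<And>a. lact (mat_of a) v = (if a = One then v else 0)"
    "\<And>a. ract v (mat_of a) = (if a = One then v else 0)"
  shows "set w \<subseteq> {X, Y} \<Longrightarrow>
    word_T (\<lambda>s. if s = w then v else 0) (a # r) = - (if a = One \<and> r = w then v else 0)"
proof (induction w arbitrary: a r)
  case Nil
  show ?case
  proof (cases r)
    case (Cons b t)
    then show ?thesis by (cases "mul a b") simp_all
  qed (simp add: v)
next
  case (Cons l w)
  show ?case
  proof (cases r)
    case Nil
    then show ?thesis by simp
  next
    case r: (Cons b t)
    have "(\<lambda>s. if a # s = l # w then v else 0) = (if a = l then (\<lambda>s. if s = w then v else 0) else (\<lambda>s. 0))"
      by auto
    then have T: "word_T (\<lambda>s. if a # s = l # w then v else 0) (b # t) =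
        (if a = l then - (if b = One \<and> t = w then v else 0) else 0)"
      using Cons.IH[of b t] Cons.prems by simp
    \<comment> \<open>A product equals \<open>X\<close> or \<open>Y\<close> only when one factor is
      the unit.\<close>
    have "l = X \<or> l = Y" using Cons.prems by auto
    then show ?thesis
      using T unfolding r by (cases a; cases b) auto
  qed
qed

lemma word_D_delta:
  assumes v: "\<And>a. lact (mat_of a) v = (if a = One then v else 0)"
    "\<And>a. ract v (mat_of a) = (if a = One then v else 0)" and w: "set w \<subseteq> {X, Y}"
  shows "word_D (\<lambda>s. if s = w then v else 0) ws = 0"
  using word_D_delta_aux[OF v w] by (cases ws) (auto simp: v)

section \<open>The Koszul complex with coefficients in M/N\<close>

definition koszul_word :: "nat \<Rightarrow> nat \<Rightarrow> letter list" where
  "koszul_word n i = replicate i Y @ replicate (n - i) X"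

lemma length_koszul_word [simp]: "i \<le> n \<Longrightarrow> length (koszul_word n i) = n"
  by (simp add: koszul_word_def)

lemma count_Y_koszul_word [simp]: "length (filter (\<lambda>a. a = Y) (koszul_word n i)) = i"
  by (simp add: koszul_word_def)

lemma koszul_word_inject: "koszul_word n i = koszul_word n j \<longleftrightarrow> i = j"
  by (metis count_Y_koszul_word)

lemma kind_replicate_X [simp]: "kind (replicate j X) = Crit"
proof (induction j)
  case (Suc j)
  then show ?case by (cases j) (simp_all add: kind_X)
qed simp

lemma kind_koszul_word [simp]: "kind (koszul_word n i) = Crit"
proof -
  have "kind (replicate i Y @ replicate j X) = Crit" for j
    by (induction i) simp_all
  then show ?thesis by (simp add: koszul_word_def)
qed

lemma Crit_koszul_word:
  "kind ws = Crit \<Longrightarrow> \<exists>i\<le>length ws. ws = koszul_word (length ws) i"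
proof (induction ws)
  case (Cons a ws)
  show ?case
  proof (cases a)
    case Y
    then obtain i where i: "i \<le> length ws" "ws = koszul_word (length ws) i"
      using Cons by auto
    then have "a # ws = koszul_word (length (a # ws)) (Suc i)"
      using Y by (simp add: koszul_word_def)
    then show ?thesis using i by (intro exI[of _ "Suc i"]) simp
  next
    case X
    then have k: "kind ws = Crit" "\<And>r. ws \<noteq> Y # r"
      using Cons.prems by (auto simp: kind_X split: list.splits letter.splits)
    then obtain i where i: "i \<le> length ws" "ws = koszul_word (length ws) i"
      using Cons by auto
    have "i = 0" using i(2) k(2) by (cases i) (auto simp: koszul_word_def)
    then have "a # ws = koszul_word (length (a # ws)) 0"
      using X i by (simp add: koszul_word_def)
    then show ?thesis by blast
  qed (use Cons.prems in \<open>auto split: if_splits\<close>)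
qed (simp add: koszul_word_def)

lemma word_D_koszul_word:
  assumes "i \<le> Suc n"
  shows "word_D c (koszul_word (Suc n) i) =
     (if i = 0 then lact (unit_mat 1 2) (c (koszul_word n 0))
      else lact (unit_mat 2 3) (c (koszul_word n (i - 1))))
     + qscale ((-1) ^ Suc n) (if i = Suc n then ract (c (koszul_word n n)) (unit_mat 2 3)
      else ract (c (koszul_word n i)) (unit_mat 1 2))"
proof -
  let ?w = "koszul_word (Suc n) i"
  have ne: "?w \<noteq> []" using assms length_koszul_word[of i "Suc n"] by (metis list.size(3) nat.distinct(1))
  have "hd ?w = (if i = 0 then X else Y)" "tl ?w = koszul_word n (i - 1)"
    using assms by (cases i; simp add: koszul_word_def)+
  moreover have "last ?w = (if i = Suc n then Y else X)"
    "butlast ?w = koszul_word n (if i = Suc n then n else i)"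
  proof -
    consider "i = Suc n" | "i \<le> n" using assms by linarith
    then have "?w = koszul_word n (if i = Suc n then n else i) @ [if i = Suc n then Y else X]"
      by cases (simp_all add: koszul_word_def replicate_append_same Suc_diff_le
          flip: replicate_Suc)
    then show "last ?w = (if i = Suc n then Y else X)"
      "butlast ?w = koszul_word n (if i = Suc n then n else i)"
      by (simp_all only: last_snoc butlast_snoc)
  qed
  ultimately show ?thesis
    using word_D_Crit[OF kind_koszul_word ne, of c] assms by simp
qed

text \<open>Let n >= 1 and e = (-1)^n. At inner words coboundaries have equal diagonal coordinates,
  so either class would do. At i = 0, modulo coboundaries, \<open>E33\<close> is e - 1 times
  \<open>E11\<close>, that is 0 or -2 times it, so \<open>E11\<close> must be taken; at i = n the
  roles are exchanged.\<close>

definition koszul_value :: "nat \<Rightarrow> nat \<Rightarrow> ('r::comm_ring_1) MmodN" where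
  "koszul_value n i = (if i < n then unit_class 1 1 else unit_class 3 3)"

definition generator :: "nat \<Rightarrow> nat \<Rightarrow> letter list \<Rightarrow> ('r::comm_ring_1) MmodN" where
  "generator n i = (\<lambda>ws. if ws = koszul_word n i then koszul_value n i else 0)"

lemma word_D_generator: "word_D (generator n i) ws = 0"
  unfolding generator_def
  by (rule word_D_delta)
    (auto simp: koszul_value_def diagonal_class_annihilated koszul_word_def
      simp del: mat_of.simps)

lemma sum_generator:
  assumes "i \<le> n"
  shows "(\<Sum>j<n + 1. qscale (r j) (generator n j (koszul_word n i))) = qscale (r i) (koszul_value n i)"
proof -
  have "(\<Sum>j<n + 1. qscale (r j) (generator n j (koszul_word n i)))
      = (\<Sum>j<n + 1. if j = i then qscale (r i) (koszul_value n i) else 0)"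
    by (rule sum.cong) (use assms in \<open>auto simp: generator_def koszul_word_inject\<close>)
  then show ?thesis using assms by simp
qed

lemma power_minus_one_square: "(-1) ^ n * ((-1) ^ n * x) = (x :: 'r::comm_ring_1)"
  by (metis (no_types) left_minus_one_mult_self mult.assoc)

text \<open>The cochain \<open>g\<close> is read off coordinatewise: its \<open>E31\<close> part matches the \<open>E21\<close> part of \<open>c\<close>, and
  the cocycle condition then makes the \<open>E32\<close> parts agree; its \<open>E21\<close> part, and at the last word its
  \<open>E32\<close> part, match one diagonal coordinate of \<open>c\<close>, and \<open>r\<close> absorbs the other one.\<close>
lemma koszul_cocycle_decomposition:
  fixes c :: "letter list \<Rightarrow> ('r::comm_ring_1) MmodN"
  assumes cocycle: "\<And>i. i \<le> Suc (Suc m) \<Longrightarrow> word_D c (koszul_word (Suc (Suc m)) i) = 0"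
  shows "\<exists>r g. \<forall>i\<le>Suc m. c (koszul_word (Suc m) i) - qscale (r i) (koszul_value (Suc m) i)
    = word_D g (koszul_word (Suc m) i)"
proof -
  define n where "n = Suc m"
  define C where "C i = c (koszul_word n i)" for i
  define e :: 'r where "e = (-1) ^ n"
  have ee: "e * (e * x) = x" for x by (simp add: e_def power_minus_one_square)
  have e0: "e * x = 0 \<longleftrightarrow> x = 0" for x using ee[of x] by (metis mult_zero_right)
  have Z: "(if i = 0 then lact (unit_mat 1 2) (C 0) else lact (unit_mat 2 3) (C (i - 1)))
     + qscale (- e) (if i = Suc n then ract (C n) (unit_mat 2 3) else ract (C i) (unit_mat 1 2)) = 0"
    if "i \<le> Suc n" for i
    using cocycle[of i] that word_D_koszul_word[OF that, of c] unfolding C_def e_def n_def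
    by (simp only: power_Suc mult_minus1)
  have first: "entry21 (C 0) = 0"
    using arg_cong[OF Z[of 0], of diag3] by (simp add: e0)
  have last: "entry32 (C n) = 0"
    using arg_cong[OF Z[of "Suc n"], of diag1] by simp
  have p: "entry31 (C i) = 0" if "i \<le> n" for i
    using arg_cong[OF Z[of "Suc i"], of entry21] that by (simp split: if_splits)
  \<comment> \<open>This links the \<open>E32\<close> part at one word to the \<open>E21\<close>
    part at the next: in a coboundary both come from the \<open>E31\<close> part of the same value
    of \<open>g\<close>.\<close>
  have rq: "entry32 (C i) = e * entry21 (C (Suc i))" if "i < n" for i
    using arg_cong[OF Z[of "Suc i"], of diag1] that by simp
  define G where "G i = qscale (entry21 (C (Suc i))) (unit_class 3 1)
     - qscale (e * diag3 (C i)) (unit_class 2 1)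
     - (if i = m then qscale (diag1 (C n)) (unit_class 3 2) else 0)" for i
  \<comment> \<open>Counting the letters \<open>Y\<close> recovers i from
    \<open>koszul_word m i\<close>; values at other words do not affect \<open>B\<close>.\<close>
  define g where "g ws = G (length (filter (\<lambda>a. a = Y) ws))" for ws
  have g: "g (koszul_word m i) = G i" for i
    by (simp add: g_def)
  define B where "B i = word_D g (koszul_word n i)" for i
  have B: "B i = (if i = 0 then lact (unit_mat 1 2) (G 0) else lact (unit_mat 2 3) (G (i - 1)))
     + qscale e (if i = n then ract (G m) (unit_mat 2 3) else ract (G i) (unit_mat 1 2))"
    if "i \<le> n" for i
    using that word_D_koszul_word[of i m g] g by (simp add: B_def n_def e_def)
  define r where "r i = (if i < n then diag1 (C i) - diag1 (B i) else diag3 (C i) - diag3 (B i))" for i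
  have "C i - qscale (r i) (koszul_value n i) = B i" if i: "i \<le> n" for i
  proof (rule MmodN_eqI)
    consider "i = 0" | j where "i = Suc j" "j < m" | "i = n" "i \<noteq> 0"
      using i by (cases i) (auto simp: n_def less_Suc_eq_le le_less)
    note cs = this
    show "entry31 (C i - qscale (r i) (koszul_value n i)) = entry31 (B i)"
      using p[OF i] B[OF i] by (simp add: koszul_value_def)
    show "entry21 (C i - qscale (r i) (koszul_value n i)) = entry21 (B i)"
      using cs first by cases (simp_all add: koszul_value_def B i G_def n_def)
    show "entry32 (C i - qscale (r i) (koszul_value n i)) = entry32 (B i)"
      using cs last rq[of i] by cases (simp_all add: koszul_value_def B i G_def n_def)
    show "diag1 (C i - qscale (r i) (koszul_value n i)) = diag1 (B i)"
      using cs by cases (simp_all add: koszul_value_def r_def B i G_def n_def)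
    show "diag3 (C i - qscale (r i) (koszul_value n i)) = diag3 (B i)"
      using cs by cases (simp_all add: koszul_value_def r_def B i G_def n_def ee)
  qed
  then show ?thesis by (auto simp: C_def B_def n_def)
qed

text \<open>The diagonal coordinate in which the generator is 0 determines the other coordinate of
  the coboundary: they agree at inner words, and at the ends both are multiples of one entry of
  \<open>g\<close>, with coefficient a unit in the former. Hence both vanish.\<close>

lemma koszul_generators_independent:
  fixes g :: "letter list \<Rightarrow> ('r::comm_ring_1) MmodN"
  assumes eq: "\<And>i. i \<le> Suc m \<Longrightarrow>
      qscale (r i) (koszul_value (Suc m) i) = word_D g (koszul_word (Suc m) i)"
    and i: "i \<le> Suc m"
  shows "r i = 0"
proof -
  define G where "G i = g (koszul_word m i)" for i
  define e :: 'r where "e = (-1) ^ Suc m"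
  have "e * (e * x) = x" for x by (simp add: e_def power_minus_one_square del: power_Suc)
  then have e0: "e * x = 0 \<longleftrightarrow> x = 0" for x by (metis mult_zero_right)
  have E: "qscale (r i) (koszul_value (Suc m) i) =
      (if i = 0 then lact (unit_mat 1 2) (G 0) else lact (unit_mat 2 3) (G (i - 1)))
     + qscale e (if i = Suc m then ract (G m) (unit_mat 2 3) else ract (G i) (unit_mat 1 2))"
    if "i \<le> Suc m" for i
    using eq[OF that] word_D_koszul_word[OF that, of g] by (simp add: G_def e_def)
  consider "i = 0" | j where "i = Suc j" "j < m" | "i = Suc m"
    using i by (cases i) (auto simp: le_less)
  then show ?thesis
  proof cases
    case 1
    have "entry21 (G 0) = 0"
      using arg_cong[OF E[of 0], of diag3] by (simp add: koszul_value_def e0)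
    then show ?thesis
      using 1 arg_cong[OF E[of 0], of diag1] by (simp add: koszul_value_def)
  next
    case 2
    then show ?thesis
      using arg_cong[OF E[of i], of diag1] arg_cong[OF E[of i], of diag3]
      by (simp add: koszul_value_def)
  next
    case 3
    have "entry32 (G m) = 0"
      using arg_cong[OF E[of "Suc m"], of diag1] by (simp add: koszul_value_def)
    then show ?thesis
      using 3 arg_cong[OF E[of "Suc m"], of diag3] by (simp add: koszul_value_def)
  qed
qed

section \<open>Hochschild cohomology\<close>

lemma hoch_cochains_lincomb:
  "(\<And>i. z i \<in> hoch_cochains n) \<Longrightarrow> hoch_lincomb k r z \<in> hoch_cochains n"
proof (induction k)
  case 0
  show ?case by (simp add: hoch_lincomb_def hoch_cochains_iff multilin_zero)
next
  case (Suc k)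
  then show ?case
    by (simp add: hoch_lincomb_def hoch_cochains_iff multilin_add multilin_qscale)
qed

lemma hoch_cochains_diff:
  "f \<in> hoch_cochains n \<Longrightarrow> g \<in> hoch_cochains n \<Longrightarrow> (\<lambda>xs. f xs - g xs) \<in> hoch_cochains n"
  by (simp add: hoch_cochains_iff multilin_diff)

lemma generator_cocycle: "cochain_of n (generator n i) \<in> hoch_cocycles n"
proof -
  have "word_D (\<lambda>ws. cochain_of n (generator n i) (map mat_of ws)) ws = word_D (generator n i) ws"
    if "length ws = Suc n" for ws
    using that by (intro word_D_cong) (simp add: cochain_of_words)
  then show ?thesis
    unfolding hoch_cocycles_iff word_D_generator using cochain_of_in_cochains by blast
qed

lemma hoch_free_of_rank_Suc: "hoch_free_of_rank TYPE('r::comm_ring_1) (Suc m) (Suc m + 1)"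
proof -
  let ?n = "Suc m"
  let ?z = "\<lambda>i. cochain_of ?n (generator ?n i) :: 'r mat3 list \<Rightarrow> 'r MmodN"
  let ?comb = "\<lambda>r. hoch_lincomb (?n + 1) r ?z"
  have comb: "?comb r \<in> hoch_cochains ?n" for r
    by (rule hoch_cochains_lincomb) (rule cochain_of_in_cochains)
  have comb_words: "?comb r (map mat_of ws) = (\<Sum>j<?n + 1. qscale (r j) (generator ?n j ws))"
    if "length ws = ?n" for r ws
    by (simp add: hoch_lincomb_def cochain_of_words that)
  have comb_koszul: "?comb r (map mat_of (koszul_word ?n i)) = qscale (r i) (koszul_value ?n i)"
    if "i \<le> ?n" for r i
    using comb_words[of "koszul_word ?n i" r] sum_generator[OF that, of r] that by simp
  have comb_D: "word_D (\<lambda>ws. ?comb r (map mat_of ws)) ws = 0" if l: "length ws = Suc ?n" for r ws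
  proof -
    have D: "word_D (\<lambda>ws. \<Sum>j<k. qscale (r j) (generator ?n j ws)) ws = 0" for k
      by (induction k) (simp_all add: word_D_add word_D_qscale word_D_generator)
    have "word_D (\<lambda>ws. ?comb r (map mat_of ws)) ws
        = word_D (\<lambda>ws. \<Sum>j<?n + 1. qscale (r j) (generator ?n j ws)) ws"
      by (rule word_D_cong) (simp only: comb_words l Suc_inject)
    then show ?thesis by (simp only: D)
  qed
  have span: "\<exists>r. (\<lambda>xs. f xs - ?comb r xs) \<in> hoch_coboundaries ?n" if f: "f \<in> hoch_cocycles ?n" for f
  proof -
    let ?c = "\<lambda>ws. f (map mat_of ws)"
    have fc: "f \<in> hoch_cochains ?n" and D: "\<And>ws. length ws = Suc ?n \<Longrightarrow> word_D ?c ws = 0"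
      using f by (auto simp: hoch_cocycles_iff)
    obtain r g where rg: "\<And>i. i \<le> ?n \<Longrightarrow>
        ?c (koszul_word ?n i) - qscale (r i) (koszul_value ?n i) = word_D g (koszul_word ?n i)"
      using koszul_cocycle_decomposition[of m ?c] D by auto
    \<comment> \<open>Removing the Koszul coboundary of \<open>g\<close> makes the difference vanish
      on all critical words, so the matching applies to it.\<close>
    let ?h = "\<lambda>ws. (?c ws - ?comb r (map mat_of ws)) - word_D g ws"
    have "\<exists>g'. \<forall>ws. length ws = ?n \<longrightarrow> ?h ws = word_D g' ws"
    proof (rule word_cocycle_vanishing_on_Crit)
      fix ws :: "letter list"
      assume l: "length ws = Suc ?n"
      then show "word_D ?h ws = 0"
        using D[OF l] comb_D[OF l, of r] word_D_word_D[of ws g] by (simp add: word_D_diff)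
    next
      fix ws :: "letter list"
      assume l: "length ws = ?n" and "kind ws = Crit"
      then obtain i where "i \<le> ?n" "ws = koszul_word ?n i"
        using Crit_koszul_word[of ws] by metis
      then show "?h ws = 0" using rg[of i] comb_koszul[of i r] by simp
    qed
    then obtain g' where g': "\<And>ws. length ws = ?n \<Longrightarrow> ?h ws = word_D g' ws" by blast
    let ?b = "cochain_of m (\<lambda>ws. g' ws + g ws)"
    have "(\<lambda>xs. f xs - ?comb r xs) = hoch_d m ?b"
    proof (rule hoch_cochains_eqI)
      show "(\<lambda>xs. f xs - ?comb r xs) \<in> hoch_cochains ?n"
        by (rule hoch_cochains_diff[OF fc comb])
      show "hoch_d m ?b \<in> hoch_cochains ?n"
        by (rule hoch_d_in_cochains[OF cochain_of_in_cochains])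
      fix ws :: "letter list"
      assume l: "length ws = ?n"
      have "hoch_d m ?b (map mat_of ws) = word_D (\<lambda>ws. g' ws + g ws) ws"
        unfolding hoch_d_words[OF cochain_of_in_cochains l]
        by (rule word_D_cong) (simp add: cochain_of_words l)
      also have "\<dots> = ?c ws - ?comb r (map mat_of ws)"
        using g'[OF l] by (simp add: word_D_add algebra_simps)
      finally show "f (map mat_of ws) - ?comb r (map mat_of ws) = hoch_d m ?b (map mat_of ws)" by simp
    qed
    then show ?thesis
      using cochain_of_in_cochains by (auto simp: hoch_coboundaries_def)
  qed
  have indep: "\<forall>i<?n + 1. r i = 0" if cob: "?comb r \<in> hoch_coboundaries ?n" for r
  proof -
    obtain b where b: "b \<in> hoch_cochains m" "?comb r = hoch_d m b"
      using cob by (auto simp: hoch_coboundaries_def)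
    have "qscale (r i) (koszul_value ?n i) = word_D (\<lambda>ws. b (map mat_of ws)) (koszul_word ?n i)"
      if "i \<le> ?n" for i
      using comb_koszul[OF that, of r] hoch_d_words[OF b(1), of "koszul_word ?n i"] b(2) that by simp
    from koszul_generators_independent[OF this] show ?thesis by simp
  qed
  show ?thesis
    unfolding hoch_free_of_rank_def
    by (intro exI[of _ ?z] conjI allI impI ballI)
      (simp_all only: generator_cocycle span, use indep in blast)
qed

text \<open>Commuting with x and y forces the three entries below the diagonal to vanish. As only 0
  is a coboundary, both diagonal coordinates survive.\<close>

lemma hoch_free_of_rank_0: "hoch_free_of_rank TYPE('r::comm_ring_1) 0 2"
proof -
  define v :: "nat \<Rightarrow> 'r MmodN" where "v i = (if i = 0 then unit_class 1 1 else unit_class 3 3)" for i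
  define z where "z i = cochain_of 0 (\<lambda>ws. if ws = [] then v i else 0)" for i
  have comb_Nil: "hoch_lincomb 2 r z [] = qscale (r 0) (v 0) + qscale (r 1) (v 1)" for r
    by (simp add: hoch_lincomb_def z_def cochain_of_def numeral_2_eq_2)
  have cocycles: "z i \<in> hoch_cocycles 0" for i
  proof -
    have "word_D (\<lambda>ws. z i (map mat_of ws)) ws = word_D (\<lambda>ws. if ws = [] then v i else 0) ws"
      if "length ws = Suc 0" for ws
      using that by (intro word_D_cong) (simp add: z_def cochain_of_def)
    also have "word_D (\<lambda>ws. if ws = [] then v i else 0) ws = 0" for ws
      by (rule word_D_delta) (simp_all add: v_def diagonal_class_annihilated del: mat_of.simps)
    finally show ?thesis
      unfolding hoch_cocycles_iff z_def using cochain_of_in_cochains by blast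
  qed
  have span: "\<exists>r. (\<lambda>xs. f xs - hoch_lincomb 2 r z xs) \<in> hoch_coboundaries 0"
    if f: "f \<in> hoch_cocycles 0" for f
  proof -
    have fc: "f \<in> hoch_cochains 0" using f by (simp add: hoch_cocycles_iff)
    have D: "word_D (\<lambda>ws. f (map mat_of ws)) ws = 0" if "length ws = Suc 0" for ws
      using f that by (simp add: hoch_cocycles_iff)
    have x: "lact (unit_mat 1 2) (f []) - ract (f []) (unit_mat 1 2) = 0"
      and y: "lact (unit_mat 2 3) (f []) - ract (f []) (unit_mat 2 3) = 0"
      using D[of "[X]"] D[of "[Y]"] by simp_all
    define r where "r i = (if i = 0 then diag1 (f []) else diag3 (f []))" for i :: nat
    have "f [] = hoch_lincomb 2 r z []"
      unfolding comb_Nil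
      using arg_cong[OF x, of diag3] arg_cong[OF x, of entry32] arg_cong[OF y, of diag1]
      by (intro MmodN_eqI) (simp_all add: v_def r_def)
    moreover have "hoch_lincomb 2 r z \<in> hoch_cochains 0"
      by (rule hoch_cochains_lincomb) (simp add: z_def cochain_of_in_cochains)
    ultimately have "f = hoch_lincomb 2 r z"
      by (intro hoch_cochains_eqI[OF fc]) simp_all
    then show ?thesis by (intro exI[of _ r]) (simp add: hoch_coboundaries_def)
  qed
  have indep: "\<forall>i<2. r i = 0" if "hoch_lincomb 2 r z \<in> hoch_coboundaries 0" for r
  proof -
    have "hoch_lincomb 2 r z [] = 0" using that by (simp add: hoch_coboundaries_def)
    then have "qscale (r 0) (v 0) + qscale (r 1) (v 1) = 0" by (simp only: comb_Nil)
    from arg_cong[OF this, of diag1] arg_cong[OF this, of diag3] show ?thesis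
      by (simp add: v_def less_2_cases_iff)
  qed
  show ?thesis
    unfolding hoch_free_of_rank_def
    by (intro exI[of _ z] conjI allI impI ballI) (simp_all only: cocycles span, use indep in blast)
qed

theorem theorem5p4:
  shows "\<forall>n::nat. hoch_free_of_rank TYPE('r::comm_ring_1) n (if n = 0 then 2 else n + 1)"
  using hoch_free_of_rank_0 hoch_free_of_rank_Suc by (metis not0_implies_Suc)

end
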